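(* Let $(\widehat{\mathbb{R}}_1,s_1)$ and $(\widehat{\mathbb{R}}_2,s_2)$ be two fields, each with a fixed scale, and each satisfying Axioms 1--6 listed in the context. Then there exists a field isomorphism $\Phi:\widehat{\mathbb{R}}_1\to\widehat{\mathbb{R}}_2$ which preserves the scale, i.e. $\Phi(s_1)=s_2$. Consequently, the algebraically closed fields $\widehat{\mathbb{C}}_1=\widehat{\mathbb{R}}_1(i)$ and $\widehat{\mathbb{C}}_2=\widehat{\mathbb{R}}_2(i)$ are isomorphic as fields. In other words, a field satisfying Axioms 1--6, if it exists, is unique up to a field isomorphism preserving the scale, and $\widehat{\mathbb{C}}=\widehat{\mathbb{R}}(i)$ is also uniquely determined up to a field isomorphism.
   Context: Let $\mathfrak{c}=\mathrm{card}(\mathbb{R})$ and let $\mathfrak{c}^+$ be its cardinal successor. A field $\widehat{\mathbb{R}}$ is said to satisfy Axioms 1--6 (with scale $s$) if: Axiom 1. $\widehat{\mathbb{R}}$ is a real closed field. (It is then uniquely ordered by: $x\ge 0$ iff $x=y^2$ for some $y\in\widehat{\mathbb{R}}$; all order notions below, absolute values and intervals refer to this order, and $\widehat{\mathbb{R}}$ carries the order (interval) topology.) Axiom 2. $\widehat{\mathbb{R}}$ contains $\mathbb{R}$ as a proper subfield. Axiom 3. $\widehat{\mathbb{R}}$ is Cantor $\mathfrak{c}^+$-complete: every family $\{[a_\gamma,b_\gamma]\}_{\gamma\in\Gamma}$ of closed intervals in $\widehat{\mathbb{R}}$ with the finite intersection property and $\mathrm{card}(\Gamma)\le\mathfrak{c}$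 has non-empty intersection. Axiom 4. $\mathrm{card}(\widehat{\mathbb{R}})=\mathfrak{c}^+$. Axiom 5. $\widehat{\mathbb{R}}$ contains an infinitesimal scale $s$, i.e. an element $s\in\widehat{\mathbb{R}}$ such that (a) $0<s<1/n$ for all $n\in\mathbb{N}$; (b) the sequence of intervals $(-s^n,s^n)$, $n\in\mathbb{N}$, is a base of neighborhoods of zero in the order topology of $\widehat{\mathbb{R}}$. Such an $s$ is fixed. Axiom 6. There is a strictly decreasing function $\exp_s:\mathcal{F}(\widehat{\mathbb{R}})\to\widehat{\mathbb{R}}_+$ which is a group isomorphism from $(\mathcal{F}(\widehat{\mathbb{R}}),+)$ onto $(\widehat{\mathbb{R}}_+,\cdot)$ and satisfies $\exp_s(q)=s^q$ for all $q\in\mathbb{Q}$. Here $\mathcal{F}(\widehat{\mathbb{R}})=\{x\in\widehat{\mathbb{R}}:|x|\le n\text{ for some }n\in\mathbb{N}\}$ is the ring of finite elements, $\widehat{\mathbb{R}}_+$ is the set of positive elements, and $s^q$ is the rational power, well defined since $\widehat{\mathbb{R}}$ is real closed. *)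

theory Defs
  imports Complex_Main "HOL-Computational_Algebra.Polynomial"
begin

unbundle cardinal_syntax

section \<open>Field homomorphisms and real closed fields\<close>

definition is_field_hom :: "('a::field \<Rightarrow> 'b::field) \<Rightarrow> bool" where
  "is_field_hom f \<longleftrightarrow>
     f 1 = 1 \<and> (\<forall>x y. f (x + y) = f x + f y) \<and> (\<forall>x y. f (x * y) = f x * f y)"

definition is_field_iso :: "('a::field \<Rightarrow> 'b::field) \<Rightarrow> bool" where
  "is_field_iso f \<longleftrightarrow> is_field_hom f \<and> bij f"

text \<open>
  The order of a real closed field is determined by its field structure (see
  \<open>real_closed_nonneg_iff_square\<close>), so taking the order from the class \<open>linordered_field\<close>
  adds no data.  Likewise the class \<open>linorder_topology\<close>, used below, fixes the topology
  to be the order topology.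
\<close>

definition real_closed :: "'a::linordered_field itself \<Rightarrow> bool" where
  "real_closed _ \<longleftrightarrow>
     (\<forall>x::'a. 0 \<le> x \<longrightarrow> (\<exists>y. x = y\<^sup>2)) \<and>
     (\<forall>p::'a poly. odd (degree p) \<longrightarrow> (\<exists>x. poly p x = 0))"

lemma real_closed_nonneg_iff_square:
  assumes "real_closed TYPE('a::linordered_field)"
  shows "0 \<le> (x::'a) \<longleftrightarrow> (\<exists>y. x = y\<^sup>2)"
  using assms by (auto simp: real_closed_def)

lemma real_closed_root_exists:
  assumes rc: "real_closed TYPE('a::linordered_field)"
  shows "0 < n \<Longrightarrow> 0 < (a::'a) \<Longrightarrow> \<exists>y>0. y ^ n = a"
proof (induction n arbitrary: a rule: less_induct)
  case (less n)
  show ?case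
  proof (cases "even n")
    case True
    then obtain m where m: "n = 2 * m" by blast
    with less.prems have "0 < m" "m < n" by auto
    from rc less.prems(2) obtain b :: 'a where b: "a = b\<^sup>2"
      unfolding real_closed_def by (meson less_imp_le)
    with less.prems(2) have "0 < \<bar>b\<bar>" by auto
    from less.IH[OF \<open>m < n\<close> \<open>0 < m\<close> this] obtain y where "y > 0" "y ^ m = \<bar>b\<bar>" by blast
    then have "y ^ n = a" by (simp add: m b power_mult mult.commute[of 2] del: power_mult_distrib)
    with \<open>y > 0\<close> show ?thesis by blast
  next
    case False
    have "degree (monom 1 n + [:- a:]) = n"
      using less.prems(1) by (subst degree_add_eq_left) (auto simp: degree_monom_eq)
    with rc False obtain y where "poly (monom 1 n + [:- a:]) y = 0"
      unfolding real_closed_def by metis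
    then have y: "y ^ n = a" by (simp add: poly_monom)
    then have "0 < y ^ n" using less.prems(2) by simp
    then have "y > 0" using False less.prems(1) by (auto simp: zero_less_power_eq)
    with y show ?thesis by blast
  qed
qed


section \<open>Completeness, cardinality and scales\<close>

definition contains_reals_properly :: "'a::field itself \<Rightarrow> bool" where
  "contains_reals_properly _ \<longleftrightarrow>
     (\<exists>\<iota>::real \<Rightarrow> 'a. is_field_hom \<iota> \<and> inj \<iota> \<and> range \<iota> \<noteq> UNIV)"

text \<open>
  A family of intervals enters only through the set of its members, so families indexed by
  a set of size at most the continuum are rendered as sets \<open>\<I>\<close> of intervals of at most that size.
\<close>

definition cantor_complete :: "'a::linorder itself \<Rightarrow> bool" where
  "cantor_complete _ \<longleftrightarrow>
     (\<forall>\<I> :: 'a set set.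
        (\<forall>I\<in>\<I>. \<exists>a b. I = {a..b}) \<and>
        |\<I>| \<le>o |UNIV :: real set| \<and>
        (\<forall>\<J>. \<J> \<subseteq> \<I> \<and> finite \<J> \<longrightarrow> \<Inter>\<J> \<noteq> {})
        \<longrightarrow> \<Inter>\<I> \<noteq> {})"

definition has_card_succ_continuum :: "'a itself \<Rightarrow> bool" where
  "has_card_succ_continuum _ \<longleftrightarrow> |UNIV :: 'a set| =o cardSuc |UNIV :: real set|"

definition infinitesimal_scale :: "'a::{linordered_field, linorder_topology} \<Rightarrow> bool" where
  "infinitesimal_scale s \<longleftrightarrow>
     (\<forall>n::nat. 1 \<le> n \<longrightarrow> 0 < s \<and> s < 1 / of_nat n) \<and>
     (\<forall>U. (\<exists>V. open V \<and> 0 \<in> V \<and> V \<subseteq> U) \<longleftrightarrow> (\<exists>n\<ge>1. {- (s ^ n)<..<s ^ n} \<subseteq> U))"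


section \<open>Exponentials on the finite elements\<close>

definition finite_elements :: "'a::linordered_field set" where
  "finite_elements = {x. \<exists>n::nat. \<bar>x\<bar> \<le> of_nat n}"

definition rat_power :: "'a::linordered_field \<Rightarrow> rat \<Rightarrow> 'a" where
  "rat_power x q =
     (let (m, n) = quotient_of q in THE y. 0 < y \<and> y ^ nat n = x powi m)"

lemma rat_power_well_defined:
  assumes rc: "real_closed TYPE('a::linordered_field)" and "0 < (x::'a)"
  shows "\<exists>!y. 0 < y \<and> y ^ nat (snd (quotient_of q)) = x powi fst (quotient_of q)"
proof -
  have n: "0 < nat (snd (quotient_of q))"
    using quotient_of_denom_pos'[of q] by simp
  have "0 < x powi fst (quotient_of q)"
    using assms(2) by (simp add: power_int_def)
  from real_closed_root_exists[OF rc n this] show ?thesis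
    using n by (metis less_imp_le power_eq_imp_eq_base)
qed

definition has_exponential :: "'a::linordered_field \<Rightarrow> bool" where
  "has_exponential s \<longleftrightarrow>
     (\<exists>exp_s::'a \<Rightarrow> 'a.
        strict_antimono_on finite_elements exp_s \<and>
        bij_betw exp_s finite_elements {0<..} \<and>
        (\<forall>x\<in>finite_elements. \<forall>y\<in>finite_elements. exp_s (x + y) = exp_s x * exp_s y) \<and>
        (\<forall>q::rat. exp_s (of_rat q) = rat_power s q))"

definition scaled_field :: "'a::{linordered_field, linorder_topology} \<Rightarrow> bool" where
  "scaled_field s \<longleftrightarrow>
     real_closed TYPE('a) \<and>
     contains_reals_properly TYPE('a) \<and>
     cantor_complete TYPE('a) \<and>
     has_card_succ_continuum TYPE('a) \<and>
     infinitesimal_scale s \<and>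
     has_exponential s"


section \<open>Adjoining a square root of \<open>-1\<close>\<close>

text \<open>\<open>Adjoin_i a b\<close> stands for \<open>a + b i\<close>; the operations are those of \<open>complex\<close>.\<close>

datatype 'a adjoin_i = Adjoin_i (re_i: 'a) (im_i: 'a)

instantiation adjoin_i :: (linordered_field) field
begin

definition "0 = Adjoin_i 0 0"
definition "1 = Adjoin_i 1 0"
definition "x + y = Adjoin_i (re_i x + re_i y) (im_i x + im_i y)"
definition "- x = Adjoin_i (- re_i x) (- im_i x)"
definition "x - y = Adjoin_i (re_i x - re_i y) (im_i x - im_i y)"
definition "x * y = Adjoin_i (re_i x * re_i y - im_i x * im_i y) (re_i x * im_i y + im_i x * re_i y)"
definition "inverse x = Adjoin_i (re_i x / ((re_i x)\<^sup>2 + (im_i x)\<^sup>2))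
                                 (- im_i x / ((re_i x)\<^sup>2 + (im_i x)\<^sup>2))"
definition "divide x y = x * inverse (y :: 'a adjoin_i)"

instance
proof
  fix x :: "'a adjoin_i"
  assume "x \<noteq> 0"
  then have "re_i x \<noteq> 0 \<or> im_i x \<noteq> 0"
    by (cases x) (auto simp: zero_adjoin_i_def)
  then have "(re_i x)\<^sup>2 + (im_i x)\<^sup>2 \<noteq> 0"
    by (simp add: sum_power2_eq_zero_iff)
  then show "inverse x * x = 1"
    by (simp add: inverse_adjoin_i_def times_adjoin_i_def one_adjoin_i_def
        power2_eq_square add_divide_distrib[symmetric])
qed (simp_all add: zero_adjoin_i_def one_adjoin_i_def plus_adjoin_i_def uminus_adjoin_i_def
      minus_adjoin_i_def times_adjoin_i_def inverse_adjoin_i_def divide_adjoin_i_def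
      adjoin_i.expand algebra_simps)

end

definition algebraically_closed :: "'a::field itself \<Rightarrow> bool" where
  "algebraically_closed _ \<longleftrightarrow> (\<forall>p::'a poly. 0 < degree p \<longrightarrow> (\<exists>x. poly p x = 0))"

end

theory Submission
  imports "HOL-Algebra.Algebraic_Closure_Type" Defs
begin

text \<open>
  The isomorphism is built by a back-and-forth argument of length \<open>\<cc>\<^sup>+\<close> between order preserving
  isomorphisms of subfields of cardinality at most \<open>\<cc>\<close>, starting with \<open>\<rat>(s\<^sub>1) \<rightarrow> \<rat>(s\<^sub>2)\<close>.

  A scaled field is not saturated: its positive elements have the countable coinitial sequence
  \<open>s\<^sup>n\<close>.  Completeness only provides a point weakly between the two sides of a cut.  Over a subfield
  that contains \<open>s\<close> this is enough, because an element not in the subfield keeps a distance of some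
  \<open>s\<^sup>n\<close> from each element of it.  So every cut that an element of the first field makes over a
  subfield of cardinality at most \<open>\<cc>\<close> containing \<open>s\<^sub>1\<close> is realised, after transport, in the second
  field (\<open>exists_matching_cut\<close>).

  A cut determines the extension as an ordered field once both subfields are relatively
  algebraically closed: a polynomial is a product of linear factors with matched roots and of a
  polynomial without roots, and the latter has constant sign by the intermediate value theorem
  (\<open>same_sign_at_cut\<close>).  Algebraic elements are adjoined by the same principle: if all
  roots of smaller degree are matched, then so are the roots of the derivative, and these together
  with signs locate the root that is to be matched (\<open>exists_matching_root\<close>).

  The intermediate value theorem and the algebraic closedness of \<open>R(i)\<close> are both obtained from
  square roots and roots in odd degree by Laplace's argument (\<open>laplace_root_exists\<close>), carried out
  in the algebraic closure.  The symmetric functions occurring there are iterated products over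
  roots, which lie in the base field by the Euclidean algorithm (\<open>prod_over_roots_in_subfield\<close>).
\<close>

section \<open>Partial isomorphisms and paired polynomials\<close>

text \<open>
  A partial isomorphism between two fields is kept as its graph.  A graph is symmetric in the
  two fields, so every extension lemma can be used in both directions by passing to \<open>G\<inverse>\<close>,
  unions of chains are plain set unions, and the diagonal of a subfield is a special case.  The
  condition on zero, applied to differences, makes the graph functional in both directions.
\<close>

locale partial_field_iso =
  fixes G :: "('a::field \<times> 'b::field) set"
  assumes one: "(1, 1) \<in> G"
    and add: "(x, y) \<in> G \<Longrightarrow> (x', y') \<in> G \<Longrightarrow> (x + x', y + y') \<in> G"
    and mult: "(x, y) \<in> G \<Longrightarrow> (x', y') \<in> G \<Longrightarrow> (x * x', y * y') \<in> G"
    and uminus: "(x, y) \<in> G \<Longrightarrow> (- x, - y) \<in> G"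
    and inverse: "(x, y) \<in> G \<Longrightarrow> (inverse x, inverse y) \<in> G"
    and zero_iff: "(x, y) \<in> G \<Longrightarrow> x = 0 \<longleftrightarrow> y = 0"

text \<open>The polynomial \<open>q\<close> is the image of \<open>p\<close> under the partial map with graph \<open>G\<close>.\<close>

definition poly_pair :: "('a::zero \<times> 'b::zero) set \<Rightarrow> 'a poly \<Rightarrow> 'b poly \<Rightarrow> bool" where
  "poly_pair G p q \<longleftrightarrow> (\<forall>i. (coeff p i, coeff q i) \<in> G)"

lemma poly_pair_converse: "poly_pair (G\<inverse>) q p \<longleftrightarrow> poly_pair G p q"
  by (simp add: poly_pair_def)

lemma poly_pair_pCons: "poly_pair G (pCons a p) (pCons b q) \<longleftrightarrow> (a, b) \<in> G \<and> poly_pair G p q"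
  by (auto simp: poly_pair_def coeff_pCons split: nat.splits)

context partial_field_iso
begin

lemma zero: "(0, 0) \<in> G"
  using add[OF one uminus[OF one]] by simp

lemma diff: "(x, y) \<in> G \<Longrightarrow> (x', y') \<in> G \<Longrightarrow> (x - x', y - y') \<in> G"
  using add[of x y "- x'" "- y'"] uminus[of x' y'] by simp

lemma divide: "(x, y) \<in> G \<Longrightarrow> (x', y') \<in> G \<Longrightarrow> (x / x', y / y') \<in> G"
  using mult[of x y "inverse x'" "inverse y'"] inverse[of x' y'] by (simp add: divide_inverse)

lemma sum: "(\<And>i. i \<in> A \<Longrightarrow> (f i, g i) \<in> G) \<Longrightarrow> (sum f A, sum g A) \<in> G"
  by (induction A rule: infinite_finite_induct) (auto intro: zero add)

lemma power: "(x, y) \<in> G \<Longrightarrow> (x ^ n, y ^ n) \<in> G"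
  by (induction n) (auto intro: one mult)

lemma of_nat: "(of_nat n, of_nat n) \<in> G"
  by (induction n) (auto intro: zero one add)

lemma unique_right: "(x, y) \<in> G \<Longrightarrow> (x, y') \<in> G \<Longrightarrow> y = y'"
  using zero_iff[OF diff, of x y x y'] by simp

lemma unique_left: "(x, y) \<in> G \<Longrightarrow> (x', y) \<in> G \<Longrightarrow> x = x'"
  using zero_iff[OF diff, of x y x' y] by simp

lemma converse: "partial_field_iso (G\<inverse>)"
  by unfold_locales (auto intro: one add mult uminus inverse simp: zero_iff)

lemma poly_pair_0: "poly_pair G 0 0"
  by (simp add: poly_pair_def zero)

lemma poly_pair_1: "poly_pair G 1 1"
  by (auto simp: poly_pair_def coeff_1 zero one)

lemma poly_pair_const: "(a, b) \<in> G \<Longrightarrow> poly_pair G [:a:] [:b:]"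
  by (simp add: poly_pair_pCons poly_pair_0)

lemma poly_pair_add: "poly_pair G p q \<Longrightarrow> poly_pair G p' q' \<Longrightarrow> poly_pair G (p + p') (q + q')"
  by (simp add: poly_pair_def add)

lemma poly_pair_uminus: "poly_pair G p q \<Longrightarrow> poly_pair G (- p) (- q)"
  by (simp add: poly_pair_def uminus)

lemma poly_pair_diff: "poly_pair G p q \<Longrightarrow> poly_pair G p' q' \<Longrightarrow> poly_pair G (p - p') (q - q')"
  by (simp add: poly_pair_def diff)

lemma poly_pair_mult: "poly_pair G p q \<Longrightarrow> poly_pair G p' q' \<Longrightarrow> poly_pair G (p * p') (q * q')"
  by (auto simp: poly_pair_def coeff_mult intro!: sum mult)

lemma poly_pair_smult: "(a, b) \<in> G \<Longrightarrow> poly_pair G p q \<Longrightarrow> poly_pair G (smult a p) (smult b q)"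
  by (simp add: poly_pair_def mult)

lemma poly_pair_pderiv: "poly_pair G p q \<Longrightarrow> poly_pair G (pderiv p) (pderiv q)"
  unfolding poly_pair_def coeff_pderiv by (blast intro: mult of_nat)

lemma poly_pair_eval: "poly_pair G p q \<Longrightarrow> (x, y) \<in> G \<Longrightarrow> (poly p x, poly q y) \<in> G"
  by (induction p q rule: poly_induct2) (auto simp: poly_pair_pCons intro: zero add mult)

lemma poly_pair_synthetic_div:
  "poly_pair G p q \<Longrightarrow> (x, y) \<in> G \<Longrightarrow> poly_pair G (synthetic_div p x) (synthetic_div q y)"
  by (induction p q rule: poly_induct2)
    (auto simp: poly_pair_pCons poly_pair_0 intro: poly_pair_eval)

lemma poly_pair_degree: "poly_pair G p q \<Longrightarrow> degree p = degree q"
  unfolding poly_pair_def by (metis zero_iff coeff_0 degree_0 leading_coeff_0_iff le_degree le_antisym le0)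

lemma poly_pair_eq_0_iff: "poly_pair G p q \<Longrightarrow> p = 0 \<longleftrightarrow> q = 0"
  by (metis poly_pair_def poly_eq_iff zero_iff coeff_0)

lemma poly_pair_division:
  assumes m: "poly_pair G m m'" "m \<noteq> 0"
  shows "poly_pair G p p' \<Longrightarrow> \<exists>h h' r r'. poly_pair G h h' \<and> poly_pair G r r' \<and>
    p = m * h + r \<and> p' = m' * h' + r' \<and> (r = 0 \<or> degree r < degree m)"
proof (induction p p' rule: poly_induct2)
  case 0
  show ?case
    by (intro exI[of _ 0]) (simp add: poly_pair_0)
next
  case (pCons a p a' p')
  from pCons.prems have a: "(a, a') \<in> G" and p: "poly_pair G p p'"
    by (simp_all add: poly_pair_pCons)
  from pCons.IH[OF p] obtain h h' r r' where
    h: "poly_pair G h h'" and r: "poly_pair G r r'" and eq: "p = m * h + r" "p' = m' * h' + r'"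
    and deg: "r = 0 \<or> degree r < degree m"
    by blast
  define c where "c = coeff (pCons a r) (degree m) / lead_coeff m"
  define c' where "c' = coeff (pCons a' r') (degree m) / lead_coeff m'"
  have ar: "poly_pair G (pCons a r) (pCons a' r')"
    using a r by (simp add: poly_pair_pCons)
  have cc: "(c, c') \<in> G"
    unfolding c_def c'_def using ar m poly_pair_degree[OF m(1)]
    by (auto intro!: divide simp: poly_pair_def)
  have "degree (pCons a r - smult c m) < degree m \<or> pCons a r - smult c m = 0"
  proof -
    have "coeff (pCons a r - smult c m) (degree m) = 0"
      using m(2) by (simp add: c_def)
    moreover have "degree (pCons a r) \<le> degree m"
      using deg by auto
    then have "degree (pCons a r - smult c m) \<le> degree m"
      by (meson degree_diff_le degree_smult_le le_trans order_refl)
    ultimately show ?thesis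
      by (metis eq_zero_or_degree_less)
  qed
  moreover have "pCons a p = m * pCons c h + (pCons a r - smult c m)"
    by (simp add: eq(1))
  moreover have "pCons a' p' = m' * pCons c' h' + (pCons a' r' - smult c' m')"
    by (simp add: eq(2))
  moreover have "poly_pair G (pCons c h) (pCons c' h')"
    using h cc by (simp add: poly_pair_pCons)
  moreover have "poly_pair G (pCons a r - smult c m) (pCons a' r' - smult c' m')"
    using ar cc m(1) by (intro poly_pair_diff poly_pair_smult)
  ultimately show ?case
    by blast
qed

end


section \<open>Subfields of an algebraically closed field\<close>

locale subfield_set =
  fixes K :: "'a::field set"
  assumes K_one: "1 \<in> K"
    and K_add: "x \<in> K \<Longrightarrow> y \<in> K \<Longrightarrow> x + y \<in> K"
    and K_mult: "x \<in> K \<Longrightarrow> y \<in> K \<Longrightarrow> x * y \<in> K"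
    and K_uminus: "x \<in> K \<Longrightarrow> - x \<in> K"
    and K_inverse: "x \<in> K \<Longrightarrow> inverse x \<in> K"

sublocale subfield_set \<subseteq> diag: partial_field_iso "Id_on K"
  by unfold_locales (auto intro: K_one K_add K_mult K_uminus K_inverse)

definition poly_over :: "'a::zero set \<Rightarrow> 'a poly \<Rightarrow> bool" where
  "poly_over K p \<longleftrightarrow> (\<forall>i. coeff p i \<in> K)"

lemma poly_over_pCons: "poly_over K (pCons a p) \<longleftrightarrow> a \<in> K \<and> poly_over K p"
  by (auto simp: poly_over_def coeff_pCons split: nat.splits)

lemma poly_pair_Id_on: "poly_pair (Id_on K) p q \<longleftrightarrow> p = q \<and> poly_over K p"
  by (auto simp: poly_pair_def poly_over_def poly_eq_iff Id_on_def)

context subfield_set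
begin

lemma K_zero: "0 \<in> K" and K_of_nat: "of_nat n \<in> K"
  using diag.zero diag.of_nat by auto

lemma K_diff: "x \<in> K \<Longrightarrow> y \<in> K \<Longrightarrow> x - y \<in> K"
  and K_divide: "x \<in> K \<Longrightarrow> y \<in> K \<Longrightarrow> x / y \<in> K"
  and K_power: "x \<in> K \<Longrightarrow> x ^ n \<in> K"
  using diag.diff[of x x y y] diag.divide[of x x y y] diag.power[of x x] by auto

lemma K_sum: "(\<And>i. i \<in> A \<Longrightarrow> f i \<in> K) \<Longrightarrow> sum f A \<in> K"
  using diag.sum[of A f f] by auto

lemma poly_over_0: "poly_over K 0"
  by (simp add: poly_over_def K_zero)

lemma poly_over_add: "poly_over K p \<Longrightarrow> poly_over K q \<Longrightarrow> poly_over K (p + q)"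
  using diag.poly_pair_add[of p p q q] by (simp add: poly_pair_Id_on)

lemma poly_over_mult: "poly_over K p \<Longrightarrow> poly_over K q \<Longrightarrow> poly_over K (p * q)"
  using diag.poly_pair_mult[of p p q q] by (simp add: poly_pair_Id_on)

lemma poly_over_eval: "poly_over K p \<Longrightarrow> x \<in> K \<Longrightarrow> poly p x \<in> K"
  using diag.poly_pair_eval[of p p x x] by (simp add: poly_pair_Id_on Id_on_iff)

lemma poly_over_division:
  assumes "poly_over K m" "m \<noteq> 0" "poly_over K p"
  obtains h r where "poly_over K h" "poly_over K r" "p = m * h + r" "r = 0 \<or> degree r < degree m"
  using diag.poly_pair_division[of m m p p] assms by (auto simp: poly_pair_Id_on)

lemma poly_over_exact_quotient:
  assumes D: "poly_over K D" "D \<noteq> 0" and DS: "poly_over K (D * S)"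
  shows "poly_over K S"
proof -
  obtain h r where h: "poly_over K h" and r: "D * S = D * h + r" "r = 0 \<or> degree r < degree D"
    using poly_over_division[OF D DS] by metis
  have eq: "D * (S - h) = r"
    using r(1) by (simp add: algebra_simps)
  have "r = 0"
  proof (rule ccontr)
    assume "r \<noteq> 0"
    then have "S - h \<noteq> 0" using eq by auto
    then have "degree D \<le> degree r" using eq D(2) by (metis degree_mult_eq le_add1)
    then show False using r(2) \<open>r \<noteq> 0\<close> by auto
  qed
  then have "S = h" using eq D(2) by auto
  then show ?thesis using h by simp
qed

end

text \<open>
  Subtracting the value at one point \<open>a\<close> and dividing by \<open>X - a\<close> gives a polynomial of smaller
  degree that takes values in \<open>K\<close> outside one more point.
\<close>

lemma (in subfield_set) poly_over_if_values:
  assumes inf: "infinite K"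
  shows "finite F \<Longrightarrow> (\<And>x. x \<in> K - F \<Longrightarrow> poly P x \<in> K) \<Longrightarrow> poly_over K P"
proof (induction "degree P" arbitrary: P F)
  case 0
  obtain c where c: "P = [:c:]"
    using 0 degree_eq_zeroE by metis
  obtain a where "a \<in> K - F"
    using inf 0 by (metis Diff_eq_empty_iff ex_in_conv finite_subset)
  then have "c \<in> K" using 0(3) c by force
  then show ?case using c by (simp add: poly_over_pCons poly_over_0)
next
  case (Suc n)
  obtain a where a: "a \<in> K - F"
    using inf Suc by (metis Diff_eq_empty_iff ex_in_conv finite_subset)
  define Q where "Q = synthetic_div P a"
  have eq: "P = [:-a, 1:] * Q + [:poly P a:]"
    unfolding Q_def by (rule synthetic_div_correct'[symmetric])
  have Pa: "poly P a \<in> K" using Suc.prems a by blast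
  have Q: "poly_over K Q"
  proof (rule Suc.hyps(1)[of Q "insert a F"])
    show "n = degree Q" using Suc.hyps(2) by (simp add: Q_def degree_synthetic_div)
    show "finite (insert a F)" using Suc.prems by simp
    fix x assume x: "x \<in> K - insert a F"
    have "poly P x = (x - a) * poly Q x + poly P a"
      by (subst eq) (simp add: algebra_simps)
    then have "poly Q x = (poly P x - poly P a) / (x - a)"
      using x by (auto simp: field_simps)
    then show "poly Q x \<in> K"
      using x a Pa Suc.prems(2)[of x] by (auto intro!: K_divide K_diff)
  qed
  have "poly_over K ([:-a, 1:] * Q + [:poly P a:])"
    using Pa Q a by (intro poly_over_add poly_over_mult)
      (auto simp: poly_over_pCons poly_over_0 K_uminus K_one)
  then show ?case using eq by simp
qed

text \<open>
  The coefficients of a monic \<open>Q\<close>, read from the top, are determined one after another by those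
  of \<open>Q\<^sup>2\<close> through linear equations with leading factor \<open>2\<close>.
\<close>

lemma (in subfield_set) poly_over_monic_sqrt:
  fixes Q :: "'a poly"
  assumes char: "(2::'a) \<noteq> 0" and QQ: "poly_over K (Q * Q)" and monic: "lead_coeff Q = 1"
  shows "poly_over K Q"
proof -
  define R where "R = reflect_poly Q"
  have RR: "poly_over K (R * R)"
    using QQ by (auto simp: R_def reflect_poly_mult[symmetric] poly_over_def coeff_reflect_poly K_zero)
  have R0: "coeff R 0 = 1" using monic by (simp add: R_def)
  have R: "coeff R j \<in> K" for j
  proof (induction j rule: less_induct)
    case (less j)
    show ?case
    proof (cases "j = 0")
      case True
      then show ?thesis by (simp add: R0 K_one)
    next
      case False
      have "coeff (R * R) j = (\<Sum>i\<le>j. coeff R i * coeff R (j - i))"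
        by (rule coeff_mult)
      also have "{..j} = insert 0 (insert j {1..<j})"
        using False by auto
      also have "(\<Sum>i\<in>insert 0 (insert j {1..<j}). coeff R i * coeff R (j - i)) =
          2 * coeff R j + (\<Sum>i\<in>{1..<j}. coeff R i * coeff R (j - i))"
        using False R0 by simp
      finally have "coeff R j = (coeff (R * R) j - (\<Sum>i\<in>{1..<j}. coeff R i * coeff R (j - i))) / 2"
        using char by (simp add: field_simps)
      moreover have "(\<Sum>i\<in>{1..<j}. coeff R i * coeff R (j - i)) \<in> K"
        using less by (intro K_sum K_mult) auto
      moreover have "coeff (R * R) j \<in> K" using RR by (simp add: poly_over_def)
      moreover have "2 \<in> K" using K_of_nat[of 2] by simp
      ultimately show ?thesis by (metis K_divide K_diff)
    qed
  qed
  have "coeff Q i \<in> K" for i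
  proof (cases "i \<le> degree Q")
    case True
    then have "coeff Q i = coeff R (degree Q - i)"
      by (simp add: R_def coeff_reflect_poly)
    then show ?thesis using R by simp
  next
    case False
    then show ?thesis by (simp add: coeff_eq_0 K_zero)
  qed
  then show ?thesis by (simp add: poly_over_def)
qed

lemma alg_closed_linear_factors:
  fixes p :: "'a::alg_closed_field poly"
  assumes "p \<noteq> 0"
  obtains \<alpha> where "p = smult (lead_coeff p) (\<Prod>i<degree p. [:- \<alpha> i, 1:])"
proof -
  obtain A where A: "size A = degree p" "p = smult (lead_coeff p) (\<Prod>x\<in>#A. [:-x, 1:])"
    using alg_closed_imp_factorization[OF assms] by blast
  obtain xs where xs: "mset xs = A" using ex_mset by blast
  have "(\<Prod>x\<in>#A. [:-x, 1:]) = prod_list (map (\<lambda>x. [:-x, 1:]) xs)"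
    unfolding xs[symmetric] by (metis mset_map prod_mset_prod_list)
  also have "\<dots> = (\<Prod>i<degree p. [:- (xs ! i), 1:])"
    using A(1) xs by (auto simp: prod.list_conv_set_nth atLeast0LessThan intro!: prod.cong)
  finally show thesis using A(2) that by metis
qed

text \<open>
  Up to sign and powers of the leading coefficients, the product of \<open>g\<close> over the roots of \<open>p\<close> is
  the resultant of \<open>p\<close> and \<open>g\<close>, hence the product of \<open>p\<close> over the roots of \<open>g\<close>.  Exchanging the
  two and replacing one by its remainder modulo the other is the Euclidean algorithm, which
  does not leave the field of coefficients.
\<close>

lemma (in subfield_set) prod_over_roots_in_subfield:
  fixes p g :: "'a poly"
  assumes splits: "\<And>q::'a poly. q \<noteq> 0 \<Longrightarrow> \<exists>\<beta>. q = smult (lead_coeff q) (\<Prod>i<degree q. [:- \<beta> i, 1:])"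
  shows "poly_over K p \<Longrightarrow> poly_over K g \<Longrightarrow> p \<noteq> 0 \<Longrightarrow>
    p = smult (lead_coeff p) (\<Prod>i<degree p. [:- \<alpha> i, 1:]) \<Longrightarrow>
    (\<Prod>i<degree p. poly g (\<alpha> i)) \<in> K"
proof (induction "degree p" arbitrary: p g \<alpha> rule: less_induct)
  case less
  note p = less.prems(1) and g = less.prems(2) and p0 = less.prems(3) and fac = less.prems(4)
  obtain h r where r: "poly_over K r" "g = p * h + r" "r = 0 \<or> degree r < degree p"
    using poly_over_division[OF p p0 g] by metis
  have poly_p: "poly p x = lead_coeff p * (\<Prod>i<degree p. x - \<alpha> i)" for x
    by (subst fac) (simp add: poly_prod)
  have "poly p (\<alpha> i) = 0" if "i < degree p" for i
    using that by (auto simp: poly_p)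
  then have "(\<Prod>i<degree p. poly g (\<alpha> i)) = (\<Prod>i<degree p. poly r (\<alpha> i))"
    by (intro prod.cong) (auto simp: r(2))
  moreover have "(\<Prod>i<degree p. poly r (\<alpha> i)) \<in> K"
  proof (cases "r = 0")
    case True
    then show ?thesis by (cases "degree p") (auto intro: K_one K_zero)
  next
    case False
    with r(3) have deg: "degree r < degree p" by simp
    obtain \<beta> where \<beta>: "r = smult (lead_coeff r) (\<Prod>j<degree r. [:- \<beta> j, 1:])"
      using splits[OF False] by blast
    have lc: "lead_coeff p \<in> K" "lead_coeff r \<in> K" "lead_coeff p \<noteq> 0"
      using p r(1) p0 by (auto simp: poly_over_def)
    have poly_r: "poly r x = lead_coeff r * (\<Prod>j<degree r. x - \<beta> j)" for x
      by (subst \<beta>) (simp add: poly_prod)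
    have "(\<Prod>i<degree p. poly r (\<alpha> i)) =
        lead_coeff r ^ degree p * (\<Prod>i<degree p. \<Prod>j<degree r. \<alpha> i - \<beta> j)"
      by (simp add: poly_r prod.distrib)
    also have "(\<Prod>i<degree p. \<Prod>j<degree r. \<alpha> i - \<beta> j) =
        (\<Prod>j<degree r. \<Prod>i<degree p. - 1 * (\<beta> j - \<alpha> i))"
      by (subst prod.swap) simp
    also have "\<dots> = (\<Prod>j<degree r. (- 1) ^ degree p * (poly p (\<beta> j) / lead_coeff p))"
      using lc(3) by (simp only: prod.distrib poly_p) simp
    also have "\<dots> = ((- 1) ^ degree p / lead_coeff p) ^ degree r * (\<Prod>j<degree r. poly p (\<beta> j))"
      by (simp add: prod.distrib prod_dividef power_divide)
    finally have eq: "(\<Prod>i<degree p. poly r (\<alpha> i)) = lead_coeff r ^ degree p *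
        (((- 1) ^ degree p / lead_coeff p) ^ degree r * (\<Prod>j<degree r. poly p (\<beta> j)))" .
    have "(\<Prod>j<degree r. poly p (\<beta> j)) \<in> K"
      by (rule less.hyps[OF deg r(1) p False \<beta>])
    then show ?thesis
      unfolding eq using lc by (intro K_mult K_power K_divide K_uminus K_one)
  qed
  ultimately show ?case by simp
qed


section \<open>Laplace's proof of the fundamental theorem of algebra\<close>

lemma prod_square_symmetric:
  fixes f :: "nat \<Rightarrow> nat \<Rightarrow> 'a::comm_monoid_mult"
  assumes "\<And>i j. f i j = f j i"
  shows "(\<Prod>j<n. \<Prod>i<n. f i j) = (\<Prod>j<n. f j j) * ((\<Prod>j<n. \<Prod>i<j. f i j) * (\<Prod>j<n. \<Prod>i<j. f i j))"
proof (induction n)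
  case (Suc n)
  have "(\<Prod>j<n. f n j) = (\<Prod>i<n. f i n)"
    using assms by (intro prod.cong) auto
  then show ?case
    using Suc by (simp add: prod.distrib ac_simps)
qed simp

text \<open>
  The polynomial whose roots are the \<open>\<alpha>\<^sub>i + \<alpha>\<^sub>j + t \<alpha>\<^sub>i \<alpha>\<^sub>j\<close> with \<open>i < j\<close> is defined over the field of
  coefficients of the polynomial with roots \<open>\<alpha>\<^sub>i\<close>.  The product over all ordered pairs is an iterated
  product over roots; dividing by the diagonal factors leaves the square of the wanted polynomial.
\<close>

lemma (in subfield_set) poly_over_pair_sums:
  fixes p :: "'a poly" and \<alpha> :: "nat \<Rightarrow> 'a"
  assumes splits: "\<And>q::'a poly. q \<noteq> 0 \<Longrightarrow> \<exists>\<beta>. q = smult (lead_coeff q) (\<Prod>i<degree q. [:- \<beta> i, 1:])"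
    and inf: "infinite K" and char: "(2::'a) \<noteq> 0"
    and p: "poly_over K p" "p \<noteq> 0" "p = smult (lead_coeff p) (\<Prod>i<degree p. [:- \<alpha> i, 1:])"
    and t: "t \<in> K"
  shows "poly_over K (\<Prod>j<degree p. \<Prod>i<j. [:- (\<alpha> i + \<alpha> j + t * \<alpha> i * \<alpha> j), 1:])"
proof -
  let ?n = "degree p"
  let ?f = "\<lambda>i j. [:- (\<alpha> i + \<alpha> j + t * \<alpha> i * \<alpha> j), 1:]"
  note in_K = prod_over_roots_in_subfield[OF splits p(1) _ p(2,3)]
  \<comment> \<open>As a polynomial in \<open>y\<close>, this is the product of the \<open>x - (y + \<alpha>\<^sub>i + t y \<alpha>\<^sub>i)\<close>.\<close>
  have inner: "poly_over K (\<Prod>i<?n. [:x - \<alpha> i, - (1 + t * \<alpha> i):])" if x: "x \<in> K" for x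
  proof (rule poly_over_if_values[OF inf finite.emptyI])
    fix y assume y: "y \<in> K - {}"
    have "(\<Prod>i<?n. poly [:x - y, - (1 + t * y):] (\<alpha> i)) \<in> K"
      using x y t by (intro in_K) (auto simp: poly_over_pCons poly_over_0 intro!: K_diff K_add K_one K_mult K_uminus)
    then show "poly (\<Prod>i<?n. [:x - \<alpha> i, - (1 + t * \<alpha> i):]) y \<in> K"
      by (simp add: poly_prod algebra_simps)
  qed
  have square: "poly_over K (\<Prod>j<?n. \<Prod>i<?n. ?f i j)"
  proof (rule poly_over_if_values[OF inf finite.emptyI])
    fix x assume x: "x \<in> K - {}"
    have "(\<Prod>j<?n. poly (\<Prod>i<?n. [:x - \<alpha> i, - (1 + t * \<alpha> i):]) (\<alpha> j)) \<in> K"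
      using x by (intro in_K inner) auto
    then show "poly (\<Prod>j<?n. \<Prod>i<?n. ?f i j) x \<in> K"
      by (simp add: poly_prod algebra_simps)
  qed
  have diagonal: "poly_over K (\<Prod>j<?n. ?f j j)"
  proof (rule poly_over_if_values[OF inf finite.emptyI])
    fix x assume x: "x \<in> K - {}"
    have "2 \<in> K" using K_of_nat[of 2] by simp
    then have "(\<Prod>j<?n. poly [:x, - 2, - t:] (\<alpha> j)) \<in> K"
      using x t by (intro in_K) (auto simp: poly_over_pCons poly_over_0 intro!: K_uminus)
    then show "poly (\<Prod>j<?n. ?f j j) x \<in> K"
      by (simp add: poly_prod algebra_simps)
  qed
  have "(\<Prod>j<?n. \<Prod>i<?n. ?f i j) =
      (\<Prod>j<?n. ?f j j) * ((\<Prod>j<?n. \<Prod>i<j. ?f i j) * (\<Prod>j<?n. \<Prod>i<j. ?f i j))"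
    by (rule prod_square_symmetric) (simp add: ac_simps)
  with square have "poly_over K ((\<Prod>j<?n. ?f j j) * ((\<Prod>j<?n. \<Prod>i<j. ?f i j) * (\<Prod>j<?n. \<Prod>i<j. ?f i j)))"
    by simp
  moreover have "(\<Prod>j<?n. ?f j j) \<noteq> 0"
    by (simp add: prod_zero_iff)
  ultimately have "poly_over K ((\<Prod>j<?n. \<Prod>i<j. ?f i j) * (\<Prod>j<?n. \<Prod>i<j. ?f i j))"
    using poly_over_exact_quotient[OF diagonal] by blast
  then show ?thesis
    by (rule poly_over_monic_sqrt[OF char]) (simp add: lead_coeff_prod)
qed

text \<open>
  Induction on the exponent of \<open>2\<close> in the degree \<open>n\<close>: the polynomial of the \<open>\<alpha>\<^sub>i + \<alpha>\<^sub>j + t \<alpha>\<^sub>i \<alpha>\<^sub>j\<close>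
  has degree \<open>n (n - 1) / 2\<close>, with one factor \<open>2\<close> less, so one of these elements lies in \<open>C\<close>.  As
  there are finitely many pairs and infinitely many \<open>t\<close>, one pair serves two values of \<open>t\<close>; then
  \<open>\<alpha>\<^sub>i + \<alpha>\<^sub>j\<close> and \<open>\<alpha>\<^sub>i \<alpha>\<^sub>j\<close> lie in \<open>C\<close>, and \<open>\<alpha>\<^sub>i\<close> is obtained from them with a square root.
\<close>

theorem laplace_root_exists:
  fixes K C :: "'a::{alg_closed_field, field_char_0} set"
  assumes K: "subfield_set K" and C: "subfield_set C" and KC: "K \<subseteq> C"
    and odd_root: "\<And>p. poly_over K p \<Longrightarrow> odd (degree p) \<Longrightarrow> \<exists>x\<in>C. poly p x = 0"
    and sqrt: "\<And>z. z \<in> C \<Longrightarrow> \<exists>w\<in>C. w\<^sup>2 = z"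
    and p: "poly_over K p" "degree p > 0"
  shows "\<exists>x\<in>C. poly p x = 0"
proof -
  interpret K: subfield_set K by (rule K)
  interpret C: subfield_set C by (rule C)
  have splits: "\<exists>\<beta>. q = smult (lead_coeff q) (\<Prod>i<degree q. [:- \<beta> i, 1:])" if "q \<noteq> 0" for q :: "'a poly"
    using alg_closed_linear_factors[OF that] by metis
  have inf: "infinite K"
    using K.K_of_nat by (metis finite_subset image_subset_iff infinite_UNIV_char_0 inj_of_nat finite_imageD UNIV_I)
  have "\<exists>x\<in>C. poly p x = 0" if "poly_over K p" "degree p = 2 ^ k * m" "odd m" for p k m
    using that
  proof (induction k arbitrary: p m)
    case 0
    then show ?case using odd_root by simp
  next
    case (Suc k)
    let ?n = "degree p"
    have n0: "?n > 0" using Suc.prems(2,3) by (auto intro: odd_pos)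
    then have p0: "p \<noteq> 0" by auto
    obtain \<alpha> where \<alpha>: "p = smult (lead_coeff p) (\<Prod>i<?n. [:- \<alpha> i, 1:])"
      using splits[OF p0] by blast
    have poly_p: "poly p x = lead_coeff p * (\<Prod>i<?n. x - \<alpha> i)" for x
      by (subst \<alpha>) (simp add: poly_prod)
    have root: "poly p (\<alpha> i) = 0" if "i < ?n" for i
      using that by (auto simp: poly_p)
    define h where "h t i j = \<alpha> i + \<alpha> j + t * \<alpha> i * \<alpha> j" for t i j
    have "\<exists>i j. i < j \<and> j < ?n \<and> h (of_nat t) i j \<in> C" for t :: nat
    proof -
      let ?Q = "\<Prod>j<?n. \<Prod>i<j. [:- h (of_nat t) i j, 1:]"
      have "poly_over K ?Q"
        unfolding h_def
        by (rule K.poly_over_pair_sums[OF splits inf _ Suc.prems(1) p0 \<alpha> K.K_of_nat]) auto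
      moreover have "degree ?Q = 2 ^ k * (m * (?n - 1))"
      proof -
        have "degree ?Q = (\<Sum>j<?n. j)"
          by (subst degree_prod_eq_sum_degree) (auto simp: degree_prod_eq_sum_degree prod_zero_iff)
        moreover have "2 * (\<Sum>j<N. j) = N * (N - 1)" for N :: nat
          by (induction N) (auto simp: algebra_simps)
        from this[of ?n] have "2 * (\<Sum>j<?n. j) = 2 * (2 ^ k * (m * (?n - 1)))"
          using Suc.prems(2) by simp
        ultimately show ?thesis by simp
      qed
      moreover have "odd (m * (?n - 1))"
        using Suc.prems n0 by auto
      ultimately obtain x where x: "x \<in> C" "poly ?Q x = 0"
        using Suc.IH by blast
      then obtain j i where "j < ?n" "i < j" "x = h (of_nat t) i j"
        by (auto simp: poly_prod prod_zero_iff)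
      then show ?thesis using x by blast
    qed
    then obtain I J where IJ: "\<And>t. I t < J t \<and> J t < ?n \<and> h (of_nat t) (I t) (J t) \<in> C"
      by metis
    have "\<not> inj (\<lambda>t. (I t, J t))"
    proof
      assume "inj (\<lambda>t. (I t, J t))"
      moreover have "range (\<lambda>t. (I t, J t)) \<subseteq> {..<?n} \<times> {..<?n}"
        using IJ by (auto intro: less_trans)
      then have "finite (range (\<lambda>t. (I t, J t)))"
        by (rule finite_subset) simp
      ultimately show False using finite_imageD by blast
    qed
    then obtain t t' where tt': "t \<noteq> t'" "I t = I t'" "J t = J t'"
      by (auto simp: inj_def)
    define a b where "a = \<alpha> (I t)" and "b = \<alpha> (J t)"
    have h1: "a + b + of_nat t * (a * b) \<in> C" and h2: "a + b + of_nat t' * (a * b) \<in> C"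
      using IJ[of t] IJ[of t'] tt' by (auto simp: a_def b_def h_def mult.assoc)
    have "((a + b + of_nat t * (a * b)) - (a + b + of_nat t' * (a * b))) / (of_nat t - of_nat t') \<in> C"
      by (intro C.K_divide C.K_diff h1 h2 C.K_of_nat)
    moreover have "((a + b + of_nat t * (a * b)) - (a + b + of_nat t' * (a * b))) / (of_nat t - of_nat t') = a * b"
      using tt'(1) by (simp add: field_simps)
    ultimately have ab: "a * b \<in> C" by simp
    have "(a + b + of_nat t * (a * b)) - of_nat t * (a * b) \<in> C"
      by (intro C.K_diff h1 C.K_mult C.K_of_nat ab)
    then have sum: "a + b \<in> C" by simp
    have four: "4 \<in> C" and two: "2 \<in> C" using C.K_of_nat[of 4] C.K_of_nat[of 2] by simp_all
    then have "(a + b)\<^sup>2 - 4 * (a * b) \<in> C"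
      using ab sum four by (metis C.K_diff C.K_power C.K_mult)
    then obtain w where w: "w \<in> C" "w\<^sup>2 = (a + b)\<^sup>2 - 4 * (a * b)"
      using sqrt by blast
    then have "w\<^sup>2 = (a - b)\<^sup>2" by (simp add: power2_eq_square algebra_simps)
    then have "w = a - b \<or> w = - (a - b)" using power2_eq_iff by blast
    then have "a = ((a + b) + w) / 2 \<or> b = ((a + b) + w) / 2" by auto
    moreover have "((a + b) + w) / 2 \<in> C" by (rule C.K_divide[OF C.K_add[OF sum w(1)] two])
    ultimately have "a \<in> C \<or> b \<in> C" by metis
    moreover have "poly p a = 0" "poly p b = 0"
      using IJ[of t] by (auto simp: a_def b_def intro!: root)
    ultimately show ?case by blast
  qed
  moreover obtain m where "degree p = 2 ^ multiplicity 2 (degree p) * m" "odd m"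
    using multiplicity_decompose'[of "degree p" 2] p(2) by (metis dvd_1_left odd_one neq0_conv)
  ultimately show ?thesis using p(1) by blast
qed

section \<open>Adjoining a square root of \<open>-1\<close> to a real closed field\<close>

lemma field_hom_zero: "is_field_hom h \<Longrightarrow> h 0 = 0"
  unfolding is_field_hom_def by (metis add_cancel_right_left add_0)

lemma field_hom_uminus: "is_field_hom h \<Longrightarrow> h (- x) = - h x"
  using field_hom_zero[of h] unfolding is_field_hom_def by (metis add_eq_0_iff add.right_inverse)

lemma field_hom_inverse: "is_field_hom h \<Longrightarrow> h (inverse x) = inverse (h x)"
  using field_hom_zero[of h] unfolding is_field_hom_def
  by (cases "x = 0") (auto simp: inverse_zero, metis inverse_unique right_inverse)

lemma field_hom_sum: "is_field_hom h \<Longrightarrow> h (sum f A) = (\<Sum>x\<in>A. h (f x))"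
  using field_hom_zero[of h]
  by (induction A rule: infinite_finite_induct) (auto simp: is_field_hom_def)

lemma field_hom_eq_0_iff: "is_field_hom h \<Longrightarrow> h x = 0 \<longleftrightarrow> x = 0"
  using field_hom_zero[of h] unfolding is_field_hom_def by (metis mult_zero_left right_inverse zero_neq_one)

lemma field_hom_inj: "is_field_hom h \<Longrightarrow> inj h"
  using field_hom_eq_0_iff[of h] field_hom_uminus[of h] unfolding is_field_hom_def
  by (metis add.right_inverse add_eq_0_iff injI neg_equal_iff_equal)

lemma field_hom_degree: "is_field_hom h \<Longrightarrow> degree (map_poly h p) = degree p"
  by (simp add: degree_map_poly field_hom_eq_0_iff)

lemma field_hom_map_poly_mult:
  "is_field_hom h \<Longrightarrow> map_poly h (p * q) = map_poly h p * map_poly h q"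
  by (rule poly_eqI)
    (simp add: coeff_map_poly field_hom_zero coeff_mult field_hom_sum, simp add: is_field_hom_def)

lemma field_hom_poly: "is_field_hom h \<Longrightarrow> poly (map_poly h p) (h x) = h (poly p x)"
  using field_hom_zero[of h]
  by (induction p) (auto simp: map_poly_pCons is_field_hom_def)

lemma subfield_set_range: "is_field_hom h \<Longrightarrow> subfield_set (range h)"
  by unfold_locales
    (auto simp: is_field_hom_def field_hom_uminus[symmetric] field_hom_inverse[symmetric], (metis rangeI)+)

lemma poly_over_range_map_poly:
  assumes h: "is_field_hom h" and p: "poly_over (range h) p"
  obtains r where "p = map_poly h r"
proof
  have "inv_into UNIV h 0 = 0"
    using field_hom_inj[OF h] field_hom_zero[OF h] by (metis inv_f_f)
  then show "p = map_poly h (map_poly (inv_into UNIV h) p)"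
    using p field_hom_zero[OF h]
    by (auto simp: poly_eq_iff coeff_map_poly poly_over_def f_inv_into_f)
qed

definition of_base :: "'a::linordered_field \<Rightarrow> 'a adjoin_i" where
  "of_base a = Adjoin_i a 0"

definition conj_i :: "'a::linordered_field adjoin_i \<Rightarrow> 'a adjoin_i" where
  "conj_i z = Adjoin_i (re_i z) (- im_i z)"

lemma is_field_hom_of_base: "is_field_hom of_base"
  by (simp add: is_field_hom_def of_base_def plus_adjoin_i_def times_adjoin_i_def one_adjoin_i_def)

lemma is_field_hom_conj_i: "is_field_hom conj_i"
  by (auto simp: is_field_hom_def conj_i_def plus_adjoin_i_def times_adjoin_i_def one_adjoin_i_def
      algebra_simps)

lemma conj_i_conj_i: "conj_i (conj_i z) = z"
  by (simp add: conj_i_def)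

lemma conj_i_fixed: "conj_i z = z \<longleftrightarrow> z \<in> range of_base"
  by (cases z) (auto simp: conj_i_def of_base_def)

lemma adjoin_i_sqrt_exists:
  assumes rc: "real_closed TYPE('a::linordered_field)"
  shows "\<exists>w. w\<^sup>2 = (z :: 'a adjoin_i)"
proof -
  have sq: "\<exists>y\<ge>0. y\<^sup>2 = x" if "x \<ge> 0" for x :: 'a
    using rc that unfolding real_closed_def by (metis abs_ge_zero power2_abs)
  obtain a b where z: "z = Adjoin_i a b" by (cases z)
  obtain r where r: "r \<ge> 0" "r\<^sup>2 = a\<^sup>2 + b\<^sup>2" using sq[of "a\<^sup>2 + b\<^sup>2"] by auto
  have "\<bar>a\<bar> \<le> r"
    using r by (metis abs_le_square_iff abs_of_nonneg le_add_same_cancel1 zero_le_power2)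
  then have "(r + a) / 2 \<ge> 0" "(r - a) / 2 \<ge> 0" by auto
  then obtain x y where x: "x \<ge> 0" "x\<^sup>2 = (r + a) / 2" and y: "y \<ge> 0" "y\<^sup>2 = (r - a) / 2"
    using sq by metis
  have re: "x\<^sup>2 - y\<^sup>2 = a" using x y by (simp add: field_simps)
  have "(2 * x * y)\<^sup>2 = b\<^sup>2"
  proof -
    have "(2 * x * y)\<^sup>2 = 4 * x\<^sup>2 * y\<^sup>2" by (simp add: power_mult_distrib)
    also have "\<dots> = r\<^sup>2 - a\<^sup>2" unfolding x(2) y(2) by (simp add: power2_eq_square field_simps)
    finally show ?thesis using r(2) by simp
  qed
  then have im: "2 * x * y = b \<or> 2 * x * (- y) = b"
    by (auto simp: power2_eq_iff)
  have "(Adjoin_i x y)\<^sup>2 = z \<or> (Adjoin_i x (- y))\<^sup>2 = z"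
    using re im by (auto simp: z power2_eq_square times_adjoin_i_def)
  then show ?thesis by blast
qed

text \<open>
  Inside an algebraic closure, Laplace's argument applies to the base field \<open>K\<close> and the image \<open>C\<close> of
  \<open>K(i)\<close>, in which square roots exist by the formula for \<open>\<surd>(a + b i)\<close>.
\<close>

lemma base_poly_root_exists:
  fixes r :: "'a::linordered_field poly"
  assumes rc: "real_closed TYPE('a)" and r: "degree r > 0"
  shows "\<exists>z. poly (map_poly of_base r) z = 0"
proof -
  obtain \<iota> :: "'a alg_closure" where \<iota>: "\<iota>\<^sup>2 = - 1"
    using nth_root_exists[of 2 "- 1"] by auto
  define j where "j z = to_ac (re_i z) + \<iota> * to_ac (im_i z)" for z :: "'a adjoin_i"
  have ii: "\<iota> * (\<iota> * x) = - x" for x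
    using \<iota> by (metis mult.assoc mult_minus1 power2_eq_square)
  have j: "is_field_hom j"
    by (auto simp: is_field_hom_def j_def plus_adjoin_i_def times_adjoin_i_def one_adjoin_i_def
        algebra_simps ii)
  have ac: "is_field_hom (to_ac :: 'a \<Rightarrow> 'a alg_closure)"
    by (simp add: is_field_hom_def)
  have j_base: "j (of_base a) = to_ac a" for a
    by (simp add: j_def of_base_def)
  have map: "map_poly to_ac p = map_poly j (map_poly of_base p)" for p
    by (simp add: poly_eq_iff coeff_map_poly j_base field_hom_zero[OF j] field_hom_zero[OF is_field_hom_of_base])
  have "\<exists>x\<in>range j. poly (map_poly to_ac r) x = 0"
  proof (rule laplace_root_exists)
    show "subfield_set (range (to_ac :: 'a \<Rightarrow> 'a alg_closure))" "subfield_set (range j)"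
      by (rule subfield_set_range ac j)+
    show "range to_ac \<subseteq> range j"
      using j_base by (metis image_subsetI rangeI)
    show "\<exists>x\<in>range j. poly p x = 0" if p: "poly_over (range to_ac) p" "odd (degree p)" for p
    proof -
      obtain q :: "'a poly" where q: "p = map_poly to_ac q"
        using poly_over_range_map_poly[OF ac p(1)] by blast
      then have "odd (degree q)" using p(2) field_hom_degree[OF ac] by metis
      then obtain x where "poly q x = 0" using rc unfolding real_closed_def by blast
      then have "poly p (to_ac x) = 0" by (simp add: q field_hom_poly[OF ac])
      then show ?thesis using j_base by (metis rangeI)
    qed
    show "\<exists>w\<in>range j. w\<^sup>2 = z" if z: "z \<in> range j" for z
    proof -
      obtain y where "z = j y" using z by blast
      moreover obtain w where "w\<^sup>2 = y" using adjoin_i_sqrt_exists[OF rc] by blast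
      ultimately have "(j w)\<^sup>2 = z" using j by (auto simp: power2_eq_square is_field_hom_def)
      then show ?thesis by blast
    qed
    show "poly_over (range to_ac) (map_poly to_ac r)"
      by (simp add: poly_over_def coeff_map_poly)
    show "0 < degree (map_poly to_ac r :: 'a alg_closure poly)"
      using r field_hom_degree[OF ac] by metis
  qed
  then obtain z where "j (poly (map_poly of_base r) z) = 0"
    by (auto simp: map field_hom_poly[OF j])
  then show ?thesis by (auto simp: field_hom_eq_0_iff[OF j])
qed

theorem real_closed_adjoin_i_algebraically_closed:
  assumes rc: "real_closed TYPE('a::linordered_field)"
  shows "algebraically_closed TYPE('a adjoin_i)"
  unfolding algebraically_closed_def
proof (intro allI impI)
  fix p :: "'a adjoin_i poly"
  assume deg: "0 < degree p"
  note cj = is_field_hom_conj_i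
  \<comment> \<open>The product of \<open>p\<close> with its conjugate is a polynomial over the base field.\<close>
  have "map_poly conj_i (p * map_poly conj_i p) = p * map_poly conj_i p"
    by (simp add: field_hom_map_poly_mult[OF cj] map_poly_map_poly field_hom_zero[OF cj] o_def
        conj_i_conj_i mult.commute)
  then have "poly_over (range of_base) (p * map_poly conj_i p)"
    unfolding poly_over_def by (metis coeff_map_poly conj_i_fixed field_hom_zero[OF cj])
  then obtain r where r: "p * map_poly conj_i p = map_poly of_base r"
    using poly_over_range_map_poly[OF is_field_hom_of_base] by blast
  have "degree r = degree (p * map_poly conj_i p)"
    by (metis r field_hom_degree[OF is_field_hom_of_base])
  also have "\<dots> = degree p + degree p"
    using deg field_hom_degree[OF cj, of p] by (metis degree_0 degree_mult_eq less_irrefl)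
  finally obtain z where "poly (p * map_poly conj_i p) z = 0"
    using base_poly_root_exists[OF rc, of r] deg r by auto
  then consider "poly p z = 0" | "poly (map_poly conj_i p) (conj_i (conj_i z)) = 0"
    by (auto simp: conj_i_conj_i)
  then show "\<exists>x. poly p x = 0"
    by cases (auto simp: field_hom_poly[OF cj] field_hom_eq_0_iff[OF cj])
qed


section \<open>Intermediate values and Rolle's theorem for polynomials\<close>

text \<open>
  A root outside the interval contributes a linear factor of constant sign.  If a
  nonconstant polynomial has no root in the base field, it has one of the form \<open>u + i w\<close> with
  \<open>w \<noteq> 0\<close>, which contributes the positive factor \<open>(X - u)\<^sup>2 + w\<^sup>2\<close>.
\<close>

lemma real_closed_rootless_same_sign:
  assumes rc: "real_closed TYPE('a::linordered_field)" and ab: "(a::'a) \<le> b"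
  shows "(\<And>x. a \<le> x \<Longrightarrow> x \<le> b \<Longrightarrow> poly p x \<noteq> 0) \<Longrightarrow> 0 < poly p a * poly p b"
proof (induction "degree p" arbitrary: p rule: less_induct)
  case less
  have p0: "p \<noteq> 0" using less.prems[of a] ab by auto
  consider r where "poly p r = 0" | "degree p = 0" | "degree p > 0" "\<And>x. poly p x \<noteq> 0"
    by blast
  then show ?case
  proof cases
    case 1
    then obtain q where q: "p = [:- r, 1:] * q"
      by (metis dvdE poly_eq_0_iff_dvd)
    have "degree q < degree p"
      using p0 unfolding q by (subst degree_mult_eq) auto
    moreover have "poly q x \<noteq> 0" if "a \<le> x" "x \<le> b" for x
      using less.prems[OF that] by (auto simp: q)
    ultimately have "0 < poly q a * poly q b" by (rule less.hyps)
    moreover have "0 < (a - r) * (b - r)"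
    proof -
      have "r < a \<or> b < r" using less.prems[of r] 1 by force
      then show ?thesis using ab by (auto simp: zero_less_mult_iff)
    qed
    ultimately have "0 < ((a - r) * (b - r)) * (poly q a * poly q b)" by simp
    then show ?thesis by (simp add: q algebra_simps)
  next
    case 2
    then obtain c where "p = [:c:]" by (rule degree_eq_zeroE)
    then show ?thesis using p0 by (auto simp: zero_less_mult_iff linorder_neq_iff)
  next
    case 3
    define e where "e q z = poly (map_poly of_base q) z" for q and z :: "'a adjoin_i"
    note ob = is_field_hom_of_base
    obtain z where z: "e p z = 0"
      using base_poly_root_exists[OF rc 3(1)] by (auto simp: e_def)
    obtain u w where uw: "z = Adjoin_i u w" by (cases z)
    have w: "w \<noteq> 0"
    proof
      assume "w = 0"
      then have "z = of_base u" by (simp add: uw of_base_def)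
      then have "of_base (poly p u) = 0" using z by (simp add: e_def field_hom_poly[OF ob])
      then show False using 3(2) by (simp add: field_hom_eq_0_iff[OF ob])
    qed
    have e_pCons: "e (pCons c q) x = of_base c + x * e q x" for c q x
      by (simp add: e_def map_poly_pCons field_hom_zero[OF ob])
    have e_mult: "e (q * q') x = e q x * e q' x" for q q' x
      by (simp add: e_def field_hom_map_poly_mult[OF ob])
    have e_0: "e 0 x = 0" for x by (simp add: e_def)
    have e_add: "e (q + q') x = e q x + e q' x" for q q' x
    proof -
      have "map_poly of_base (q + q') = map_poly of_base q + map_poly of_base q'"
        using is_field_hom_of_base[where ?'a = 'a] by (simp add: poly_eq_iff coeff_map_poly field_hom_zero[OF ob] is_field_hom_def)
      then show ?thesis by (simp add: e_def)
    qed
    define m where "m = [:u\<^sup>2 + w\<^sup>2, - 2 * u, 1:]"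
    have m_z: "e m z = 0"
      by (simp add: m_def e_pCons e_0 uw of_base_def times_adjoin_i_def plus_adjoin_i_def
          zero_adjoin_i_def power2_eq_square algebra_simps)
    have "degree (p mod m) < 2"
      using degree_mod_less[of m p] by (auto simp: m_def)
    then obtain c d where cd: "p mod m = [:c, d:]"
      by (metis One_nat_def degree_pCons_eq degree_eq_zeroE less_2_cases not_less_eq pCons_cases
          less_Suc0 numeral_2_eq_2 pCons_0_0)
    have "e p z = e (m * (p div m)) z + e (p mod m) z"
      by (simp flip: e_add)
    then have "e [:c, d:] z = 0" using z m_z by (simp add: e_mult cd)
    then have "d * w = 0" "c + u * d = 0"
      by (simp_all add: e_pCons e_0 uw of_base_def times_adjoin_i_def plus_adjoin_i_def zero_adjoin_i_def mult.commute)
    then have "p mod m = 0" using w by (simp add: cd)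
    then have q: "p = m * (p div m)" by (metis add.right_neutral mult_div_mod_eq)
    have m_pos: "0 < poly m x" for x
    proof -
      have "poly m x = (x - u)\<^sup>2 + w\<^sup>2" by (simp add: m_def power2_eq_square algebra_simps)
      also have "\<dots> > 0" using w by (simp add: sum_power2_gt_zero_iff)
      finally show ?thesis .
    qed
    have "degree (p div m) < degree p"
      using p0 by (subst (2) q, subst degree_mult_eq) (use q in \<open>auto simp: m_def\<close>)
    moreover have "poly (p div m) x \<noteq> 0" if "a \<le> x" "x \<le> b" for x
      using less.prems[OF that] by (subst (asm) q) auto
    ultimately have "0 < poly (p div m) a * poly (p div m) b" by (rule less.hyps)
    then have "0 < (poly m a * poly m b) * (poly (p div m) a * poly (p div m) b)"
      using m_pos by simp
    also have "\<dots> = poly (m * (p div m)) a * poly (m * (p div m)) b"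
      by (simp add: algebra_simps)
    also have "\<dots> = poly p a * poly p b"
      by (simp only: q[symmetric])
    finally show ?thesis .
  qed
qed

lemma real_closed_intermediate_root:
  assumes rc: "real_closed TYPE('a::linordered_field)" and "(a::'a) < b" "poly p a * poly p b < 0"
  obtains x where "a < x" "x < b" "poly p x = 0"
proof -
  obtain x where x: "a \<le> x" "x \<le> b" "poly p x = 0"
    using real_closed_rootless_same_sign[OF rc, of a b p] assms by fastforce
  moreover from x assms(3) have "x \<noteq> a" "x \<noteq> b" by auto
  ultimately show thesis using that by force
qed

text \<open>
  Between consecutive roots \<open>u < v\<close> of \<open>p = (X - u)\<^sup>m (X - v)\<^sup>n q\<close> the derivative is, up to a factor
  without roots there, \<open>m (X - v) q + n (X - u) q + (X - u) (X - v) q'\<close>, which has opposite signs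
  at \<open>u\<close> and \<open>v\<close>.
\<close>

lemma real_closed_rolle:
  assumes rc: "real_closed TYPE('a::linordered_field)"
    and uv: "(u::'a) < v" "poly p u = 0" "poly p v = 0"
  obtains x where "u < x" "x < v" "poly (pderiv p) x = 0"
proof (cases "p = 0")
  case True
  then show thesis using that dense[OF uv(1)] by auto
next
  case False
  \<comment> \<open>The given roots need not be consecutive, so \<open>v\<close> is replaced by the first root after \<open>u\<close>.\<close>
  define S where "S = {x. u < x \<and> x \<le> v \<and> poly p x = 0}"
  have "finite S" unfolding S_def by (rule finite_subset[OF _ poly_roots_finite[OF False]]) auto
  moreover have "v \<in> S" using uv by (simp add: S_def)
  ultimately obtain v' where v': "v' \<in> S" "\<And>x. x \<in> S \<Longrightarrow> v' \<le> x"
    by (metis Min_in Min_le empty_iff)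
  have uv': "u < v'" "v' \<le> v" "poly p v' = 0" using v'(1) by (auto simp: S_def)
  obtain q1 where q1: "p = [:- u, 1:] ^ order u p * q1" "\<not> [:- u, 1:] dvd q1"
    using order_decomp[OF False] by blast
  then have "q1 \<noteq> 0" by auto
  then obtain q where q: "q1 = [:- v', 1:] ^ order v' q1 * q" "\<not> [:- v', 1:] dvd q"
    using order_decomp by blast
  obtain m where m: "order u p = Suc m"
    using uv(2) False order_root by (metis not0_implies_Suc)
  have "poly q1 v' = 0" using uv' by (subst (asm) q1(1)) auto
  then obtain n where n: "order v' q1 = Suc n"
    using \<open>q1 \<noteq> 0\<close> order_root by (metis not0_implies_Suc)
  define A B where "A = [:- u, 1:]" and "B = [:- v', 1:]"
  have p: "p = A ^ Suc m * (B ^ Suc n * q)"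
    using q1(1) q(1) m n by (simp only: A_def B_def)
  have q_nz: "poly q x \<noteq> 0" if x: "u \<le> x" "x \<le> v'" for x
  proof
    assume x0: "poly q x = 0"
    show False
    proof (cases "x = u \<or> x = v'")
      case True
      then have "[:- u, 1:] dvd q \<or> [:- v', 1:] dvd q"
        using x0 by (auto simp: poly_eq_0_iff_dvd)
      moreover have "q dvd q1" by (subst q(1)) simp
      ultimately show False using q(2) q1(2) dvd_trans by blast
    next
      case False
      then have "x \<in> S" using x uv' x0 by (auto simp: S_def p)
      then show False using v'(2) False x by fastforce
    qed
  qed
  define br where "br = smult (of_nat (Suc m)) (B * q) + smult (of_nat (Suc n)) (A * q) + A * B * pderiv q"
  have dA: "pderiv A = 1" "pderiv B = 1" by (simp_all add: A_def B_def pderiv_pCons one_pCons)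
  have "pderiv p = A ^ Suc m * (B ^ Suc n * pderiv q + smult (of_nat (Suc n)) (B ^ n) * q) +
      smult (of_nat (Suc m)) (A ^ m) * (B ^ Suc n * q)"
    unfolding p pderiv_mult pderiv_power_Suc dA by (simp add: algebra_simps)
  then have dp: "pderiv p = A ^ m * B ^ n * br"
    by (simp add: br_def algebra_simps)
  have "poly br u * poly br v' =
      - (of_nat (Suc m) * of_nat (Suc n) * (v' - u) * (v' - u) * (poly q u * poly q v'))"
    by (simp add: br_def A_def B_def algebra_simps)
  also have "\<dots> < 0"
    using uv' real_closed_rootless_same_sign[OF rc _ q_nz, of u v'] by (simp del: of_nat_Suc)
  finally obtain x where "u < x" "x < v'" "poly br x = 0"
    using real_closed_intermediate_root[OF rc uv'(1)] by blast
  then show thesis using that[of x] uv' by (simp add: dp)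
qed

text \<open>Here \<open>p = (X - \<alpha>) q\<close>, and \<open>q\<close> has no root in the interval, hence constant sign.\<close>

lemma real_closed_side_of_root:
  assumes rc: "real_closed TYPE('a::linordered_field)"
    and \<alpha>: "(u::'a) < \<alpha>" "\<alpha> < w" "poly p \<alpha> = 0"
    and dp: "\<And>x. u < x \<Longrightarrow> x < w \<Longrightarrow> poly (pderiv p) x \<noteq> 0"
    and a: "u \<le> a" "a \<le> w"
  shows "a < \<alpha> \<longleftrightarrow> 0 < poly p u * poly p a" and "\<alpha> < a \<longleftrightarrow> poly p u * poly p a < 0"
proof -
  obtain q where q: "p = [:- \<alpha>, 1:] * q"
    using \<alpha>(3) by (metis dvdE poly_eq_0_iff_dvd)
  have q_nz: "poly q x \<noteq> 0" if x: "u \<le> x" "x \<le> w" for x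
  proof
    assume x0: "poly q x = 0"
    consider "x < \<alpha>" | "x = \<alpha>" | "\<alpha> < x" by force
    then show False
    proof cases
      case 1
      then show False
        using real_closed_rolle[OF rc 1, of p] x0 \<alpha> dp x by (force simp: q)
    next
      case 2
      then have "poly (pderiv p) \<alpha> = 0"
        using x0 unfolding q pderiv_mult by (simp add: pderiv_pCons)
      then show False using dp \<alpha> by blast
    next
      case 3
      then show False
        using real_closed_rolle[OF rc 3, of p] x0 \<alpha> dp x by (force simp: q)
    qed
  qed
  have "0 < poly q u * poly q a"
    using a by (intro real_closed_rootless_same_sign[OF rc] q_nz) auto
  moreover have "poly p u * poly p a = ((\<alpha> - u) * (\<alpha> - a)) * (poly q u * poly q a)"
    by (simp add: q algebra_simps)
  ultimately show "a < \<alpha> \<longleftrightarrow> 0 < poly p u * poly p a" "\<alpha> < a \<longleftrightarrow> poly p u * poly p a < 0"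
    using \<alpha> by (auto simp: zero_less_mult_iff mult_less_0_iff)
qed

section \<open>Extending order preserving partial isomorphisms by one element\<close>

definition same_sign :: "'a::linordered_field \<Rightarrow> 'b::linordered_field \<Rightarrow> bool" where
  "same_sign x y \<longleftrightarrow> (0 < x \<longleftrightarrow> 0 < y) \<and> (x < 0 \<longleftrightarrow> y < 0)"

lemma same_sign_mult: "same_sign x y \<Longrightarrow> same_sign x' y' \<Longrightarrow> same_sign (x * x') (y * y')"
  by (auto simp: same_sign_def zero_less_mult_iff mult_less_0_iff)

lemma same_sign_divide: "same_sign x y \<Longrightarrow> same_sign x' y' \<Longrightarrow> same_sign (x / x') (y / y')"
  by (auto simp: same_sign_def zero_less_divide_iff divide_less_0_iff)

lemma same_sign_eq_0_iff: "same_sign x y \<Longrightarrow> x = 0 \<longleftrightarrow> y = 0"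
  by (auto simp: same_sign_def)

locale ordered_partial_iso = partial_field_iso G
  for G :: "('a::linordered_field \<times> 'b::linordered_field) set" +
  assumes pos_iff: "(x, y) \<in> G \<Longrightarrow> 0 < x \<longleftrightarrow> 0 < y"
begin

lemma less_iff: "(x, y) \<in> G \<Longrightarrow> (x', y') \<in> G \<Longrightarrow> x < x' \<longleftrightarrow> y < y'"
  using pos_iff[OF diff, of x' y' x y] by simp

lemma le_iff: "(x, y) \<in> G \<Longrightarrow> (x', y') \<in> G \<Longrightarrow> x \<le> x' \<longleftrightarrow> y \<le> y'"
  using less_iff[of x' y' x y] by (simp add: not_less[symmetric])

lemma same_sign: "(x, y) \<in> G \<Longrightarrow> same_sign x y"
  using less_iff[OF zero, of x y] less_iff[OF _ zero, of x y] by (simp add: same_sign_def)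

lemma ordered_converse: "ordered_partial_iso (G\<inverse>)"
  by (intro ordered_partial_iso.intro converse) (unfold_locales, auto simp: pos_iff)

end

definition adjoin_pair ::
    "('a::linordered_field \<times> 'b::linordered_field) set \<Rightarrow> 'a \<Rightarrow> 'b \<Rightarrow> ('a \<times> 'b) set" where
  "adjoin_pair G \<alpha> \<beta> = {(poly p \<alpha> / poly m \<alpha>, poly q \<beta> / poly n \<beta>) | p q m n.
     poly_pair G p q \<and> poly_pair G m n \<and> poly m \<alpha> \<noteq> 0}"

text \<open>
  The sizes of extensions are bounded by placing them inside a product of fixed subfields.
\<close>

lemma adjoin_pair_subset:
  assumes "subfield_set A" "subfield_set B" "G \<subseteq> A \<times> B" "\<alpha> \<in> A" "\<beta> \<in> B"
  shows "adjoin_pair G \<alpha> \<beta> \<subseteq> A \<times> B"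
proof -
  interpret A: subfield_set A by fact
  interpret B: subfield_set B by fact
  have "poly_over A p \<and> poly_over B q" if "poly_pair G p q" for p q
    using that assms(3) by (auto simp: poly_pair_def poly_over_def)
  then show ?thesis
    using assms(4,5) by (auto simp: adjoin_pair_def intro!: A.K_divide B.K_divide A.poly_over_eval B.poly_over_eval)
qed

text \<open>
  Agreement of signs includes agreement of zeros, so it makes \<open>p(\<alpha>) / m(\<alpha>) \<mapsto> q(\<beta>) / n(\<beta>)\<close> at once
  well defined, injective and order preserving.  This covers algebraic and transcendental \<open>\<alpha>\<close> alike.
\<close>

lemma (in ordered_partial_iso) adjoin_pair_iso:
  assumes sign: "\<And>p q. poly_pair G p q \<Longrightarrow> same_sign (poly p \<alpha>) (poly q \<beta>)"
  shows "ordered_partial_iso (adjoin_pair G \<alpha> \<beta>)" "G \<subseteq> adjoin_pair G \<alpha> \<beta>" "(\<alpha>, \<beta>) \<in> adjoin_pair G \<alpha> \<beta>"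
proof -
  let ?H = "adjoin_pair G \<alpha> \<beta>"
  have intro: "(poly p \<alpha> / poly m \<alpha>, poly q \<beta> / poly n \<beta>) \<in> ?H"
    if "poly_pair G p q" "poly_pair G m n" "poly m \<alpha> \<noteq> 0" for p q m n
    using that unfolding adjoin_pair_def by blast
  have intro_poly: "(poly p \<alpha>, poly q \<beta>) \<in> ?H" if "poly_pair G p q" for p q
    using intro[OF that poly_pair_1] by simp
  have elim: thesis if "(x, y) \<in> ?H" and "\<And>p q m n. poly_pair G p q \<Longrightarrow> poly_pair G m n \<Longrightarrow>
      poly m \<alpha> \<noteq> 0 \<Longrightarrow> poly n \<beta> \<noteq> 0 \<Longrightarrow> x = poly p \<alpha> / poly m \<alpha> \<Longrightarrow> y = poly q \<beta> / poly n \<beta> \<Longrightarrow> thesis"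
    for x y thesis
    using that same_sign_eq_0_iff[OF sign] unfolding adjoin_pair_def by blast
  have sgn_H: "same_sign x y" if "(x, y) \<in> ?H" for x y
    using that by (rule elim) (auto intro: same_sign_divide sign)
  show "ordered_partial_iso ?H"
  proof
    show "(1, 1) \<in> ?H" using intro_poly[OF poly_pair_1] by simp
  next
    fix x y x' y' assume "(x, y) \<in> ?H" "(x', y') \<in> ?H"
    then obtain p q m n p' q' m' n' where *: "poly_pair G p q" "poly_pair G m n"
      "poly m \<alpha> \<noteq> 0" "poly n \<beta> \<noteq> 0" "x = poly p \<alpha> / poly m \<alpha>" "y = poly q \<beta> / poly n \<beta>"
      "poly_pair G p' q'" "poly_pair G m' n'"
      "poly m' \<alpha> \<noteq> 0" "poly n' \<beta> \<noteq> 0" "x' = poly p' \<alpha> / poly m' \<alpha>" "y' = poly q' \<beta> / poly n' \<beta>"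
      by (elim elim)
    have "(poly (p * m' + p' * m) \<alpha> / poly (m * m') \<alpha>, poly (q * n' + q' * n) \<beta> / poly (n * n') \<beta>) \<in> ?H"
      using * by (intro intro poly_pair_add poly_pair_mult) auto
    then show "(x + x', y + y') \<in> ?H" using * by (simp add: add_frac_eq)
    have "(poly (p * p') \<alpha> / poly (m * m') \<alpha>, poly (q * q') \<beta> / poly (n * n') \<beta>) \<in> ?H"
      using * by (intro intro poly_pair_mult) auto
    then show "(x * x', y * y') \<in> ?H" using * by simp
  next
    fix x y assume "(x, y) \<in> ?H"
    then obtain p q m n where *: "poly_pair G p q" "poly_pair G m n"
      "poly m \<alpha> \<noteq> 0" "poly n \<beta> \<noteq> 0" "x = poly p \<alpha> / poly m \<alpha>" "y = poly q \<beta> / poly n \<beta>"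
      by (elim elim)
    have "(poly (- p) \<alpha> / poly m \<alpha>, poly (- q) \<beta> / poly n \<beta>) \<in> ?H"
      using * by (intro intro poly_pair_uminus) auto
    then show "(- x, - y) \<in> ?H" using * by simp
    show "(inverse x, inverse y) \<in> ?H"
    proof (cases "poly p \<alpha> = 0")
      case True
      then have "poly q \<beta> = 0" using same_sign_eq_0_iff[OF sign[OF *(1)]] by simp
      then show ?thesis using True * intro_poly[OF poly_pair_0] by simp
    next
      case False
      then show ?thesis using intro[OF *(2,1)] * by simp
    qed
  qed (use sgn_H same_sign_eq_0_iff in \<open>auto simp: same_sign_def\<close>)
  show "G \<subseteq> ?H"
    using intro_poly poly_pair_const by fastforce
  show "(\<alpha>, \<beta>) \<in> ?H"
    using intro_poly[of "[:0, 1:]" "[:0, 1:]"] by (simp add: poly_pair_pCons poly_pair_0 zero one)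
qed

definition root_closed_below :: "nat \<Rightarrow> ('a::linordered_field \<times> 'b::linordered_field) set \<Rightarrow> bool" where
  "root_closed_below d G \<longleftrightarrow> (\<forall>p q. poly_pair G p q \<longrightarrow> p \<noteq> 0 \<longrightarrow> degree p < d \<longrightarrow>
     (\<forall>x. poly p x = 0 \<longrightarrow> x \<in> Domain G) \<and> (\<forall>y. poly q y = 0 \<longrightarrow> y \<in> Range G))"

lemma real_closed_rootless_same_sign':
  assumes rc: "real_closed TYPE('a::linordered_field)" and nz: "\<And>x::'a. poly p x \<noteq> 0"
  shows "0 < poly p a * poly p b"
  using real_closed_rootless_same_sign[OF rc, of a b p] real_closed_rootless_same_sign[OF rc, of b a p] nz
  by (metis linear mult.commute)

text \<open>
  A cut decides the signs of all polynomials whose roots are matched: matched roots can be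
  split off as linear factors, whose signs the cut decides, and a polynomial without roots
  has the same sign everywhere, in particular at \<open>0\<close>.
\<close>

lemma (in ordered_partial_iso) same_sign_at_cut:
  assumes rc: "real_closed TYPE('a)" "real_closed TYPE('b)"
    and closed: "root_closed_below d G"
    and \<alpha>: "\<alpha> \<notin> Domain G" and \<beta>: "\<beta> \<notin> Range G"
    and cut: "\<And>a b. (a, b) \<in> G \<Longrightarrow> a < \<alpha> \<longleftrightarrow> b < \<beta>"
  shows "poly_pair G p q \<Longrightarrow> degree p < d \<Longrightarrow> same_sign (poly p \<alpha>) (poly q \<beta>)"
proof (induction "degree p" arbitrary: p q rule: less_induct)
  case less
  note pq = less.prems(1)
  have pq0: "p = 0 \<longleftrightarrow> q = 0" using poly_pair_eq_0_iff[OF pq] .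
  consider "p = 0" | a where "p \<noteq> 0" "poly p a = 0" | "p \<noteq> 0" "\<And>x. poly p x \<noteq> 0"
    by blast
  then show ?case
  proof cases
    case 1
    then show ?thesis using pq0 by (simp add: same_sign_def)
  next
    case 2
    then obtain b where ab: "(a, b) \<in> G"
      using closed pq less.prems(2) unfolding root_closed_below_def by blast
    have "poly q b = 0"
      using zero_iff[OF poly_pair_eval[OF pq ab]] 2 by simp
    define p1 q1 where "p1 = synthetic_div p a" and "q1 = synthetic_div q b"
    have p1: "p = [:- a, 1:] * p1" and q1: "q = [:- b, 1:] * q1"
      using synthetic_div_correct'[of a p] synthetic_div_correct'[of b q] 2 \<open>poly q b = 0\<close>
      by (simp_all add: p1_def q1_def)
    have "degree p1 < degree p"
      using 2 p1 by (subst p1, subst degree_mult_eq) auto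
    moreover have "poly_pair G p1 q1"
      unfolding p1_def q1_def by (rule poly_pair_synthetic_div[OF pq ab])
    ultimately have "same_sign (poly p1 \<alpha>) (poly q1 \<beta>)"
      using less.hyps less.prems(2) by simp
    moreover have "a \<noteq> \<alpha>" "b \<noteq> \<beta>" using ab \<alpha> \<beta> by auto
    then have "same_sign (\<alpha> - a) (\<beta> - b)"
      using cut[OF ab] by (auto simp: same_sign_def)
    ultimately have "same_sign ((\<alpha> - a) * poly p1 \<alpha>) ((\<beta> - b) * poly q1 \<beta>)"
      by (rule same_sign_mult[rotated])
    then show ?thesis by (simp add: p1 q1 algebra_simps)
  next
    case 3
    have q_nz: "poly q y \<noteq> 0" for y
    proof
      assume y: "poly q y = 0"
      then obtain x where "(x, y) \<in> G"
        using closed pq 3(1) less.prems(2) unfolding root_closed_below_def by blast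
      then show False using zero_iff[OF poly_pair_eval[OF pq]] y 3(2) by blast
    qed
    have "0 < poly p 0 * poly p \<alpha>" "0 < poly q 0 * poly q \<beta>"
      using 3(2) q_nz by (auto intro!: real_closed_rootless_same_sign' rc)
    moreover have "same_sign (poly p 0) (poly q 0)"
      by (rule same_sign[OF poly_pair_eval[OF pq zero]])
    ultimately show ?thesis by (auto simp: same_sign_def zero_less_mult_iff)
  qed
qed

lemma exists_greatest_below:
  fixes S :: "'a::linorder set"
  assumes "finite S" "S \<subseteq> D" "a0 \<in> D" "a0 < \<alpha>"
  obtains u where "u \<in> D" "u < \<alpha>" "\<And>x. x \<in> S \<Longrightarrow> x < \<alpha> \<Longrightarrow> x \<le> u"
proof
  let ?M = "insert a0 {x \<in> S. x < \<alpha>}"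
  have "Max ?M \<in> ?M" using assms(1) by (intro Max_in) auto
  then show "Max ?M \<in> D" "Max ?M < \<alpha>" using assms by auto
  show "x \<le> Max ?M" if "x \<in> S" "x < \<alpha>" for x
    using that assms(1) by (intro Max_ge) auto
qed

lemma exists_least_above:
  fixes S :: "'a::linorder set"
  assumes "finite S" "S \<subseteq> D" "a0 \<in> D" "\<alpha> < a0"
  obtains w where "w \<in> D" "\<alpha> < w" "\<And>x. x \<in> S \<Longrightarrow> \<alpha> < x \<Longrightarrow> w \<le> x"
proof
  let ?M = "insert a0 {x \<in> S. \<alpha> < x}"
  have "Min ?M \<in> ?M" using assms(1) by (intro Min_in) auto
  then show "Min ?M \<in> D" "\<alpha> < Min ?M" using assms by auto
  show "Min ?M \<le> x" if "x \<in> S" "\<alpha> < x" for x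
    using that assms(1) by (intro Min_le) auto
qed

text \<open>
  Let \<open>\<alpha>\<close> be an unmatched root of least possible degree, with polynomial \<open>p\<close>.  The roots of the
  derivative are matched, so \<open>\<alpha>\<close> can be enclosed between matched \<open>u < w\<close> with \<open>p'\<close> nonzero in
  between.  The side of \<open>\<alpha>\<close> on which a matched element lies is then read off from the sign of \<open>p\<close>,
  so the unique root of the image polynomial between the images of \<open>u\<close> and \<open>w\<close> realises the same
  cut.  Degrees from \<open>degree p\<close> on are handled by division with remainder by \<open>p\<close>.
\<close>

lemma (in ordered_partial_iso) exists_matching_root:
  assumes rc: "real_closed TYPE('a)" "real_closed TYPE('b)"
    and cofinal: "\<And>x::'a. \<exists>a\<in>Domain G. x < a"
    and closed: "root_closed_below (degree p) G"
    and pq: "poly_pair G p q" "p \<noteq> 0" and \<alpha>: "poly p \<alpha> = 0" "\<alpha> \<notin> Domain G"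
  obtains \<beta> where "poly q \<beta> = 0" "\<And>f g. poly_pair G f g \<Longrightarrow> same_sign (poly f \<alpha>) (poly g \<beta>)"
proof -
  have deg: "degree p > 0"
    using pq(2) \<alpha>(1) by (metis degree_eq_zeroE neq0_conv poly_pCons mult_zero_right poly_0 add.right_neutral pCons_0_0)
  let ?S = "{x. poly (pderiv p) x = 0}"
  have dp: "poly_pair G (pderiv p) (pderiv q)" "pderiv p \<noteq> 0" "degree (pderiv p) < degree p"
    using pq deg by (auto intro: poly_pair_pderiv simp: pderiv_eq_0_iff degree_pderiv)
  have S: "finite ?S" "?S \<subseteq> Domain G"
    using closed dp by (auto simp: root_closed_below_def intro: poly_roots_finite)
  \<comment> \<open>Cofinality supplies endpoints when \<open>p'\<close> has no root on one side of \<open>\<alpha>\<close>.\<close>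
  obtain a0 where a0: "a0 \<in> Domain G" "\<alpha> < a0" using cofinal by blast
  obtain a1 where a1: "a1 \<in> Domain G" "- \<alpha> < a1" using cofinal by blast
  then have "- a1 \<in> Domain G" "- a1 < \<alpha>" using uminus by auto
  then obtain u where u: "u \<in> Domain G" "u < \<alpha>" "\<And>x. x \<in> ?S \<Longrightarrow> x < \<alpha> \<Longrightarrow> x \<le> u"
    using exists_greatest_below[OF S] by metis
  obtain w where w: "w \<in> Domain G" "\<alpha> < w" "\<And>x. x \<in> ?S \<Longrightarrow> \<alpha> < x \<Longrightarrow> w \<le> x"
    using exists_least_above[OF S a0] by metis
  obtain u' w' where u': "(u, u') \<in> G" and w': "(w, w') \<in> G" using u(1) w(1) by blast
  have p'_nz: "poly (pderiv p) x \<noteq> 0" if "u < x" "x < w" for x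
  proof
    assume "poly (pderiv p) x = 0"
    then have "x \<in> ?S" by simp
    then have "\<not> x < \<alpha>" "\<not> \<alpha> < x" using u(3) w(3) that by fastforce+
    then show False using \<open>x \<in> ?S\<close> S(2) \<alpha>(2) by force
  qed
  have q'_nz: "poly (pderiv q) y \<noteq> 0" if "u' < y" "y < w'" for y
  proof
    assume y: "poly (pderiv q) y = 0"
    then obtain x where x: "(x, y) \<in> G"
      using closed dp unfolding root_closed_below_def by blast
    then have "poly (pderiv p) x = 0"
      using zero_iff[OF poly_pair_eval[OF dp(1) x]] y by simp
    then show False using p'_nz less_iff[OF u' x] less_iff[OF x w'] that by blast
  qed
  have sgn_pq: "same_sign (poly p u * poly p a) (poly q u' * poly q b)" if "(a, b) \<in> G" for a b
    by (intro same_sign mult poly_pair_eval[OF pq(1)] u' that)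
  have side: "a < \<alpha> \<longleftrightarrow> 0 < poly p u * poly p a" "\<alpha> < a \<longleftrightarrow> poly p u * poly p a < 0"
    if "u \<le> a" "a \<le> w" for a
    using real_closed_side_of_root[OF rc(1) u(2) w(2) \<alpha>(1) p'_nz that] by blast+
  have "poly q u' * poly q w' < 0"
    using side(2)[of w] sgn_pq[OF w'] u(2) w(2) by (auto simp: same_sign_def)
  moreover have "u' < w'" using less_iff[OF u' w'] u(2) w(2) by simp
  ultimately obtain \<beta> where \<beta>: "u' < \<beta>" "\<beta> < w'" "poly q \<beta> = 0"
    using real_closed_intermediate_root[OF rc(2)] by blast
  have side': "b < \<beta> \<longleftrightarrow> 0 < poly q u' * poly q b" if "u' \<le> b" "b \<le> w'" for b
    using real_closed_side_of_root(1)[OF rc(2) \<beta> q'_nz that] .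
  have \<beta>_new: "\<beta> \<notin> Range G"
  proof
    assume "\<beta> \<in> Range G"
    then obtain a where a: "(a, \<beta>) \<in> G" by blast
    then have "u < a" "a < w" using less_iff[OF u' a] less_iff[OF a w'] \<beta> by auto
    moreover have "poly p a = 0"
      using zero_iff[OF poly_pair_eval[OF pq(1) a]] \<beta> by simp
    ultimately have "\<not> a < \<alpha>" "\<not> \<alpha> < a" using side[of a] by auto
    then show False using \<alpha>(2) a by force
  qed
  have cut: "a < \<alpha> \<longleftrightarrow> b < \<beta>" if ab: "(a, b) \<in> G" for a b
  proof -
    consider "a < u" | "u \<le> a" "a \<le> w" | "w < a" by force
    then show ?thesis
    proof cases
      case 1
      then show ?thesis using less_iff[OF ab u'] u(2) \<beta>(1) by auto
    next
      case 2
      then show ?thesis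
        using side(1) side'[of b] sgn_pq[OF ab] le_iff[OF u' ab] le_iff[OF ab w']
        by (simp add: same_sign_def)
    next
      case 3
      then show ?thesis using less_iff[OF w' ab] w(2) \<beta>(2) by auto
    qed
  qed
  show thesis
  proof
    show "poly q \<beta> = 0" by (rule \<beta>(3))
    fix f g assume fg: "poly_pair G f g"
    obtain h h' r r' where r: "poly_pair G r r'" "f = p * h + r" "g = q * h' + r'"
      "r = 0 \<or> degree r < degree p"
      using poly_pair_division[OF pq fg] by blast
    have "same_sign (poly r \<alpha>) (poly r' \<beta>)"
      using same_sign_at_cut[OF rc closed \<alpha>(2) \<beta>_new cut r(1)] r(4) deg by fastforce
    then show "same_sign (poly f \<alpha>) (poly g \<beta>)"
      by (simp add: r(2,3) \<alpha>(1) \<beta>(3))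
  qed
qed

unbundle cardinal_syntax

section \<open>Extensions by at most continuum many elements\<close>

abbreviation small :: "'a set \<Rightarrow> bool" where
  "small A \<equiv> |A| \<le>o |UNIV :: real set|"

lemma small_subset: "A \<subseteq> B \<Longrightarrow> small B \<Longrightarrow> small A"
  using card_of_mono1 ordLeq_transitive by blast

lemma small_image: "small A \<Longrightarrow> small (f ` A)"
  using card_of_image ordLeq_transitive by blast

lemma small_UN: "small I \<Longrightarrow> (\<And>i. i \<in> I \<Longrightarrow> small (A i)) \<Longrightarrow> small (\<Union>i\<in>I. A i)"
  by (rule card_of_UNION_ordLeq_infinite) (auto simp: infinite_UNIV_char_0)

lemma small_Times: "small A \<Longrightarrow> small B \<Longrightarrow> small (A \<times> B)"
  by (rule card_of_Times_ordLeq_infinite_Field[OF _ _ _ card_of_Card_order]) (simp_all add: infinite_UNIV_char_0 Field_card_of)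

lemma small_Un: "small A \<Longrightarrow> small B \<Longrightarrow> small (A \<union> B)"
  by (rule card_of_Un_ordLeq_infinite_Field[OF _ _ _ card_of_Card_order]) (simp_all add: infinite_UNIV_char_0 Field_card_of)

lemma small_converse: "small G \<Longrightarrow> small (G\<inverse>)"
  by (rule small_subset[OF _ small_image[of G prod.swap]]) force+

lemma small_finite: "finite A \<Longrightarrow> small A"
  using infinite_UNIV_char_0 by (metis card_of_ordLeq_infinite card_of_Well_order ordLeq_total)

lemma small_UNIV_nat: "small (UNIV :: nat set)"
  using infinite_iff_card_of_nat infinite_UNIV_char_0 by blast

lemma small_range_rat: "small (range (f :: rat \<Rightarrow> 'a))"
proof -
  have "inj (of_rat :: rat \<Rightarrow> real)" by (simp add: inj_def)
  then have "small (UNIV :: rat set)" using card_of_ordLeq[of UNIV UNIV] by blast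
  then show ?thesis by (rule small_image)
qed

lemma small_polys:
  assumes "small S"
  shows "small {p. poly_over S p}"
proof -
  define P where "P n = ((\<lambda>Y. (\<lambda>(a, p). pCons a p) ` (S \<times> Y)) ^^ n) {0}" for n :: nat
  have "small (P n)" for n
    by (induction n) (simp_all add: P_def small_image small_Times assms small_finite)
  moreover have "p \<in> (\<Union>n. P n)" if "poly_over S p" for p
    using that
  proof (induction p)
    case 0
    have "0 \<in> P 0" by (simp add: P_def)
    then show ?case by blast
  next
    case (pCons a p)
    then obtain n where "p \<in> P n" "a \<in> S" by (auto simp: poly_over_pCons)
    then have "pCons a p \<in> P (Suc n)" by (force simp: P_def)
    then show ?case by blast
  qed
  ultimately have "small (\<Union>n. P n)" "{p. poly_over S p} \<subseteq> (\<Union>n. P n)"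
    by (blast intro: small_UN[OF small_UNIV_nat])+
  then show ?thesis by (rule small_subset[rotated])
qed

text \<open>
  Countably many rounds of closing under the field operations and under roots suffice, since a
  polynomial has finitely many coefficients.
\<close>

lemma exists_small_root_closed_subfield:
  fixes S :: "'a::field set"
  assumes S: "small S"
  obtains A where "S \<subseteq> A" "small A" "subfield_set A"
    "\<And>p x. poly_over A p \<Longrightarrow> p \<noteq> 0 \<Longrightarrow> poly p x = 0 \<Longrightarrow> x \<in> A"
proof -
  define roots where "roots Y = (\<Union>p\<in>{p. poly_over Y p \<and> p \<noteq> 0}. {x::'a. poly p x = 0})" for Y
  define step where "step Y = Y \<union> {0, 1} \<union> uminus ` Y \<union> inverse ` Y \<union>
    (\<lambda>(x, y). x + y) ` (Y \<times> Y) \<union> (\<lambda>(x, y). x * y) ` (Y \<times> Y) \<union> roots Y" for Y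
  have "small (roots Y)" if "small Y" for Y
    unfolding roots_def
  proof (rule small_UN)
    show "small {p. poly_over Y p \<and> p \<noteq> 0}"
      by (rule small_subset[OF _ small_polys[OF that]]) auto
  qed (auto intro: small_finite poly_roots_finite)
  then have small_step: "small (step Y)" if "small Y" for Y
    unfolding step_def using that small_finite[of "{0, 1 :: 'a}"]
    by (intro small_Un small_image small_Times) simp_all
  define A where "A n = (step ^^ n) S" for n
  have A_Suc: "A (Suc n) = step (A n)" for n by (simp add: A_def)
  have "small (A n)" for n
    by (induction n) (simp_all add: A_def S small_step)
  then have small_A: "small (\<Union>n. A n)"
    by (intro small_UN small_UNIV_nat)
  have mono: "A m \<subseteq> A n" if "m \<le> n" for m n
    using that by (rule lift_Suc_mono_le[rotated]) (auto simp: A_Suc step_def)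
  have both: "\<exists>n. x \<in> A n \<and> y \<in> A n" if "x \<in> (\<Union>n. A n)" "y \<in> (\<Union>n. A n)" for x y
    using that mono by (metis UN_E subsetD nle_le)
  have poly_A: "\<exists>n. poly_over (A n) p" if "poly_over (\<Union>n. A n) p" for p
    using that
  proof (induction p)
    case 0
    have "0 \<in> A (Suc 0)" unfolding A_Suc by (simp add: step_def)
    then show ?case by (auto simp: poly_over_def)
  next
    case (pCons a p)
    then obtain m n where "a \<in> A m" "poly_over (A n) p" by (auto simp: poly_over_pCons)
    then have "a \<in> A (max m n)" "poly_over (A (max m n)) p"
      using mono[of m "max m n"] mono[of n "max m n"] by (auto simp: poly_over_def)
    then show ?case by (auto simp: poly_over_pCons)
  qed
  show thesis
  proof
    show "S \<subseteq> (\<Union>n. A n)" using A_def[of 0] by auto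
    show "small (\<Union>n. A n)" by (rule small_A)
    show "subfield_set (\<Union>n. A n)"
    proof
      have "1 \<in> A (Suc 0)" unfolding A_Suc by (simp add: step_def)
      then show "1 \<in> (\<Union>n. A n)" by blast
      fix x assume x: "x \<in> (\<Union>n. A n)"
      then obtain n where "x \<in> A n" by blast
      then have "- x \<in> A (Suc n)" "inverse x \<in> A (Suc n)" unfolding A_Suc step_def by blast+
      then show "- x \<in> (\<Union>n. A n)" "inverse x \<in> (\<Union>n. A n)" by blast+
      fix y assume "y \<in> (\<Union>n. A n)"
      then obtain n where "x \<in> A n" "y \<in> A n" using both x by blast
      then have "x + y \<in> A (Suc n)" "x * y \<in> A (Suc n)" unfolding A_Suc step_def by force+
      then show "x + y \<in> (\<Union>n. A n)" "x * y \<in> (\<Union>n. A n)" by blast+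
    qed
    fix p x assume p: "poly_over (\<Union>n. A n) p" "p \<noteq> 0" "poly p x = 0"
    then obtain n where "poly_over (A n) p" using poly_A by blast
    then have "x \<in> A (Suc n)" unfolding A_Suc step_def roots_def using p by blast
    then show "x \<in> (\<Union>n. A n)" by blast
  qed
qed

lemma small_adjoin_pair:
  assumes "small G"
  shows "small (adjoin_pair G \<alpha> \<beta>)"
proof -
  have sm: "small (insert \<alpha> (Domain G))" "small (insert \<beta> (Range G))"
    using assms small_image[of G fst] small_image[of G snd] small_Un[OF small_finite, of "{_}"]
    by (simp_all add: Domain_fst Range_snd)
  obtain A where A: "insert \<alpha> (Domain G) \<subseteq> A" "small A" "subfield_set A"
    by (rule exists_small_root_closed_subfield[OF sm(1)], rule that)
  obtain B where B: "insert \<beta> (Range G) \<subseteq> B" "small B" "subfield_set B"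
    by (rule exists_small_root_closed_subfield[OF sm(2)], rule that)
  have "adjoin_pair G \<alpha> \<beta> \<subseteq> A \<times> B"
    using A B by (intro adjoin_pair_subset) auto
  then show ?thesis by (rule small_subset[OF _ small_Times[OF A(2) B(2)]])
qed

lemma ordered_partial_iso_chain_Union:
  assumes "\<C> \<noteq> {}" and iso: "\<And>G. G \<in> \<C> \<Longrightarrow> ordered_partial_iso G"
    and chain: "\<And>G H. G \<in> \<C> \<Longrightarrow> H \<in> \<C> \<Longrightarrow> G \<subseteq> H \<or> H \<subseteq> G"
  shows "ordered_partial_iso (\<Union>\<C>)"
proof -
  have ops: "G \<in> \<C> \<Longrightarrow> partial_field_iso G" for G
    using iso ordered_partial_iso.axioms(1) by blast
  have both: "\<exists>G\<in>\<C>. z \<in> G \<and> z' \<in> G" if "z \<in> \<Union>\<C>" "z' \<in> \<Union>\<C>" for z z'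
    using that chain by blast
  show ?thesis
  proof
    show "(1, 1) \<in> \<Union>\<C>" using assms(1) ops partial_field_iso.one by blast
  next
    fix x y x' y' assume "(x, y) \<in> \<Union>\<C>" "(x', y') \<in> \<Union>\<C>"
    then obtain G where "G \<in> \<C>" "(x, y) \<in> G" "(x', y') \<in> G" using both by blast
    then show "(x + x', y + y') \<in> \<Union>\<C>" "(x * x', y * y') \<in> \<Union>\<C>"
      using ops[of G] partial_field_iso.add[of G] partial_field_iso.mult[of G] by blast+
  next
    fix x y assume "(x, y) \<in> \<Union>\<C>"
    then obtain G where G: "G \<in> \<C>" "(x, y) \<in> G" by blast
    interpret ordered_partial_iso G using iso G by blast
    show "(- x, - y) \<in> \<Union>\<C>" "(inverse x, inverse y) \<in> \<Union>\<C>"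
      using G uminus inverse by blast+
    show "x = 0 \<longleftrightarrow> y = 0" "0 < x \<longleftrightarrow> 0 < y"
      using G zero_iff pos_iff by blast+
  qed
qed

lemma (in ordered_partial_iso) root_closed_below_converse:
  "root_closed_below d (G\<inverse>) \<longleftrightarrow> root_closed_below d G"
proof -
  have "q \<noteq> 0 \<and> degree q < d \<longleftrightarrow> p \<noteq> 0 \<and> degree p < d" if "poly_pair G p q" for p q
    using poly_pair_degree[OF that] poly_pair_eq_0_iff[OF that] by simp
  then show ?thesis
    unfolding root_closed_below_def poly_pair_converse Domain_converse Range_converse by blast
qed

lemma (in ordered_partial_iso) exists_extension_by_root:
  assumes rc: "real_closed TYPE('a)" "real_closed TYPE('b)"
    and cofinal: "\<And>x::'a. \<exists>a\<in>Domain G. x < a"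
    and AB: "subfield_set A" "subfield_set B" "G \<subseteq> A \<times> B"
    and roots: "\<And>p x. poly_over A p \<Longrightarrow> p \<noteq> 0 \<Longrightarrow> poly p x = 0 \<Longrightarrow> x \<in> A"
      "\<And>p x. poly_over B p \<Longrightarrow> p \<noteq> 0 \<Longrightarrow> poly p x = 0 \<Longrightarrow> x \<in> B"
    and closed: "root_closed_below (degree p) G"
    and pq: "poly_pair G p q" "p \<noteq> 0" and \<alpha>: "poly p \<alpha> = 0"
  shows "\<exists>H. ordered_partial_iso H \<and> G \<subseteq> H \<and> H \<subseteq> A \<times> B \<and> \<alpha> \<in> Domain H"
proof (cases "\<alpha> \<in> Domain G")
  case True
  then show ?thesis using AB(3) ordered_partial_iso_axioms by blast
next
  case False
  obtain \<beta> where \<beta>: "poly q \<beta> = 0" "\<And>f g. poly_pair G f g \<Longrightarrow> same_sign (poly f \<alpha>) (poly g \<beta>)"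
    using exists_matching_root[OF rc cofinal closed pq \<alpha> False] by blast
  have "poly_over A p" "poly_over B q"
    using pq(1) AB(3) by (auto simp: poly_pair_def poly_over_def)
  then have "\<alpha> \<in> A" "\<beta> \<in> B"
    using roots \<alpha> \<beta>(1) pq poly_pair_eq_0_iff by blast+
  then have "adjoin_pair G \<alpha> \<beta> \<subseteq> A \<times> B"
    by (intro adjoin_pair_subset AB)
  then show ?thesis using adjoin_pair_iso[OF \<beta>(2)] by blast
qed

text \<open>
  A maximal extension need not be small, but one that is maximal inside a product of small root
  closed subfields is, and there the adjunction of a missing root is still possible.  Roots missing on the
  right are roots missing on the left for the converse graph.
\<close>

lemma exists_small_root_closed_extension:
  fixes G :: "('a::linordered_field \<times> 'b::linordered_field) set"
  assumes rc: "real_closed TYPE('a)" "real_closed TYPE('b)"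
    and G: "ordered_partial_iso G" "small G"
    and cofinal: "\<And>x. \<exists>a\<in>Domain G. x < a" "\<And>y. \<exists>b\<in>Range G. y < b"
  obtains M where "G \<subseteq> M" "ordered_partial_iso M" "small M" "\<And>d. root_closed_below d M"
proof -
  have sm: "small (Domain G)" "small (Range G)"
    using G(2) small_image[of G fst] small_image[of G snd] by (simp_all add: Domain_fst Range_snd)
  obtain A where A: "Domain G \<subseteq> A" "small A" "subfield_set A"
      "\<And>p x. poly_over A p \<Longrightarrow> p \<noteq> 0 \<Longrightarrow> poly p x = 0 \<Longrightarrow> x \<in> A"
    by (rule exists_small_root_closed_subfield[OF sm(1)], rule that)
  obtain B where B: "Range G \<subseteq> B" "small B" "subfield_set B"
      "\<And>p x. poly_over B p \<Longrightarrow> p \<noteq> 0 \<Longrightarrow> poly p x = 0 \<Longrightarrow> x \<in> B"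
    by (rule exists_small_root_closed_subfield[OF sm(2)], rule that)
  define Z where "Z = {H. ordered_partial_iso H \<and> G \<subseteq> H \<and> H \<subseteq> A \<times> B}"
  have "G \<in> Z" using G A(1) B(1) by (auto simp: Z_def)
  moreover have "\<Union>\<C> \<in> Z" if "\<C> \<noteq> {}" "subset.chain Z \<C>" for \<C>
  proof -
    have "ordered_partial_iso (\<Union>\<C>)"
      using that by (intro ordered_partial_iso_chain_Union) (auto simp: subset_chain_def Z_def)
    then show ?thesis using that unfolding subset_chain_def Z_def by blast
  qed
  ultimately have "\<exists>M\<in>Z. \<forall>Y\<in>Z. M \<subseteq> Y \<longrightarrow> Y = M"
    by (metis (mono_tags) empty_iff subset_Zorn_nonempty)
  then obtain M where M: "M \<in> Z" and max: "\<And>Y. Y \<in> Z \<Longrightarrow> M \<subseteq> Y \<Longrightarrow> Y = M"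
    by blast
  interpret M: ordered_partial_iso M using M by (simp add: Z_def)
  have GM: "G \<subseteq> M" "M \<subseteq> A \<times> B" using M by (auto simp: Z_def)
  have closed: "root_closed_below d M" for d
  proof (induction d)
    case 0
    then show ?case by (simp add: root_closed_below_def)
  next
    case (Suc d)
    have "x \<in> Domain M" if pq: "poly_pair M p q" "p \<noteq> 0" "degree p = d" and "poly p x = 0" for p q x
    proof -
      have "\<exists>H. ordered_partial_iso H \<and> M \<subseteq> H \<and> H \<subseteq> A \<times> B \<and> x \<in> Domain H"
        using cofinal(1) GM(1) Suc that
        by (intro M.exists_extension_by_root[OF rc _ A(3) B(3) GM(2) A(4) B(4)]) blast+
      then obtain H where "ordered_partial_iso H" "M \<subseteq> H" "H \<subseteq> A \<times> B" "x \<in> Domain H"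
        by blast
      moreover from this have "H = M" using max GM(1) by (auto simp: Z_def)
      ultimately show ?thesis by blast
    qed
    moreover have "y \<in> Range M" if pq: "poly_pair M p q" "p \<noteq> 0" "degree p = d" and y: "poly q y = 0" for p q y
    proof -
      have q: "q \<noteq> 0" "degree q = d" "poly_pair (M\<inverse>) q p"
        using pq M.poly_pair_degree M.poly_pair_eq_0_iff by (auto simp: poly_pair_converse)
      have "M\<inverse> \<subseteq> B \<times> A" using GM(2) by blast
      have cofinal': "\<exists>b\<in>Domain (M\<inverse>). y < b" for y
        using cofinal(2)[of y] GM(1) by blast
      have "\<exists>H. ordered_partial_iso H \<and> M\<inverse> \<subseteq> H \<and> H \<subseteq> B \<times> A \<and> y \<in> Domain H"
        using Suc q y
        by (intro ordered_partial_iso.exists_extension_by_root[OF M.ordered_converse rc(2,1) cofinal' B(3) A(3) \<open>M\<inverse> \<subseteq> B \<times> A\<close> B(4) A(4) _ q(3)])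
          (auto simp: M.root_closed_below_converse)
      then obtain H where H: "ordered_partial_iso H" "M\<inverse> \<subseteq> H" "H \<subseteq> B \<times> A" "y \<in> Domain H"
        by blast
      then have "H\<inverse> \<in> Z" "M \<subseteq> H\<inverse>"
        using GM(1) ordered_partial_iso.ordered_converse[OF H(1)] by (auto simp: Z_def)
      then have "H\<inverse> = M" using max by blast
      then show ?thesis using H(4) by (metis Range_converse)
    qed
    ultimately show ?case using Suc unfolding root_closed_below_def less_Suc_eq by blast
  qed
  have "small M" by (rule small_subset[OF GM(2) small_Times[OF A(2) B(2)]])
  then show thesis using that GM(1) M.ordered_partial_iso_axioms closed by blast
qed


section \<open>Filling cuts over small fields that contain the scale\<close>

definition null_powers :: "'a::linordered_field \<Rightarrow> bool" where
  "null_powers s \<longleftrightarrow> 0 < s \<and> (\<forall>e>0. \<exists>n. s ^ n < e)"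

lemma null_powers_cofinal:
  assumes "null_powers s"
  obtains n where "x < inverse (s ^ n)"
proof -
  have "0 < inverse (\<bar>x\<bar> + 1)" by (simp add: add_nonneg_pos)
  then obtain n where n: "s ^ n < inverse (\<bar>x\<bar> + 1)" using assms unfolding null_powers_def by blast
  have "0 < s ^ n" using assms by (simp add: null_powers_def)
  then have "\<bar>x\<bar> + 1 < inverse (s ^ n)"
    using n less_imp_inverse_less by fastforce
  then show thesis using that[of n] by linarith
qed

text \<open>
  Completeness yields a weak solution \<open>\<beta>\<close> of the inequalities that describe the cut.  It is
  strict, because the powers of the scale are matched: from \<open>a < \<alpha>\<close> follows \<open>a + s\<^sub>1\<^sup>n < \<alpha>\<close> for some
  \<open>n\<close>, so \<open>\<beta>\<close> exceeds the image of \<open>a\<close> by at least \<open>s\<^sub>2\<^sup>n\<close>.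
\<close>

lemma (in ordered_partial_iso) exists_matching_cut:
  assumes cc: "cantor_complete TYPE('b)" and sm: "small G"
    and s: "(s1, s2) \<in> G" "null_powers s1" and \<alpha>: "\<alpha> \<notin> Domain G"
  obtains \<beta> where "\<beta> \<notin> Range G" "\<And>a b. (a, b) \<in> G \<Longrightarrow> a < \<alpha> \<longleftrightarrow> b < \<beta>"
proof -
  define I where "I = (\<lambda>((a, b), (a', b')). {b..b'}) ` {((a, b), (a', b')) | a b a' b'.
    (a, b) \<in> G \<and> (a', b') \<in> G \<and> a < \<alpha> \<and> \<alpha> < a'}"
  have I_iff: "Y \<in> I \<longleftrightarrow> (\<exists>a b a' b'. (a, b) \<in> G \<and> (a', b') \<in> G \<and> a < \<alpha> \<and> \<alpha> < a' \<and> Y = {b..b'})" for Y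
    unfolding I_def by force
  have s1: "0 < s1 ^ n" for n using s(2) by (simp add: null_powers_def)
  have s2: "0 < s2 ^ n" for n using pos_iff[OF s(1)] s(2) by (simp add: null_powers_def)
  have pow: "(s1 ^ n, s2 ^ n) \<in> G" for n by (rule power[OF s(1)])
  obtain n0 where "\<alpha> < inverse (s1 ^ n0)" using null_powers_cofinal[OF s(2)] .
  then obtain hi hi' where hi: "(hi, hi') \<in> G" "\<alpha> < hi" using inverse[OF pow] by blast
  obtain n1 where "- \<alpha> < inverse (s1 ^ n1)" using null_powers_cofinal[OF s(2)] .
  then have "- inverse (s1 ^ n1) < \<alpha>" by simp
  then obtain lo lo' where lo: "(lo, lo') \<in> G" "lo < \<alpha>" using uminus[OF inverse[OF pow]] by blast
  have fip: "\<exists>a b a' b'. (a, b) \<in> G \<and> (a', b') \<in> G \<and> a < \<alpha> \<and> \<alpha> < a' \<and> {b..b'} \<subseteq> \<Inter>J"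
    if "finite J" "J \<subseteq> I" for J
    using that
  proof induction
    case empty
    then show ?case using hi lo by blast
  next
    case (insert Y J)
    then obtain a b a' b' where 1: "(a, b) \<in> G" "(a', b') \<in> G" "a < \<alpha>" "\<alpha> < a'" "{b..b'} \<subseteq> \<Inter>J"
      by blast
    have "Y \<in> I" using insert.prems by simp
    then obtain c d c' d' where 2: "(c, d) \<in> G" "(c', d') \<in> G" "c < \<alpha>" "\<alpha> < c'" "Y = {d..d'}"
      unfolding I_iff by (elim exE conjE)
    obtain e f where ef: "(e, f) \<in> G" "e < \<alpha>" "b \<le> f" "d \<le> f"
      using that[of a b] that[of c d] 1 2 linear[of b d] by auto
    obtain e' f' where ef': "(e', f') \<in> G" "\<alpha> < e'" "f' \<le> b'" "f' \<le> d'"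
      using that[of a' b'] that[of c' d'] 1 2 linear[of b' d'] by auto
    have "{f..f'} \<subseteq> {b..b'}" "{f..f'} \<subseteq> {d..d'}" using ef ef' by simp_all
    with 1(5) 2(5) have "{f..f'} \<subseteq> \<Inter>(insert Y J)" by blast
    then show ?case
      by (intro exI[of _ e] exI[of _ f] exI[of _ e'] exI[of _ f'] conjI ef(1,2) ef'(1,2))
  qed
  have "\<Inter>J \<noteq> {}" if J: "finite J" "J \<subseteq> I" for J
  proof -
    obtain a b a' b' where "(a, b) \<in> G" "(a', b') \<in> G" "a < \<alpha>" "\<alpha> < a'" "{b..b'} \<subseteq> \<Inter>J"
      using fip[OF J] by blast
    moreover from this have "b \<le> b'" using le_iff[of a b a' b'] by simp
    ultimately show ?thesis by fastforce
  qed
  moreover have "small I"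
    unfolding I_def
    by (rule small_image, rule small_subset[OF _ small_Times[OF sm sm]]) auto
  moreover have "\<forall>Y\<in>I. \<exists>b b'. Y = {b..b'}" using I_iff by blast
  ultimately have "\<Inter>I \<noteq> {}"
    using cc[unfolded cantor_complete_def, THEN spec, of I] by simp
  then obtain \<beta> where \<beta>: "\<And>Y. Y \<in> I \<Longrightarrow> \<beta> \<in> Y" by blast
  have lower: "b < \<beta>" if ab: "(a, b) \<in> G" "a < \<alpha>" for a b
  proof -
    obtain n where "s1 ^ n < \<alpha> - a" using s(2) ab(2) unfolding null_powers_def by (meson diff_gt_0_iff_gt)
    then have "a + s1 ^ n < \<alpha>" by (simp add: less_diff_eq add.commute)
    then have "{b + s2 ^ n..hi'} \<in> I" using add[OF ab(1) pow] hi I_iff by blast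
    then have "b + s2 ^ n \<le> \<beta>" using \<beta> by fastforce
    then show ?thesis using s2[of n] by (simp add: less_le_trans[rotated])
  qed
  have upper: "\<beta> < b" if ab: "(a, b) \<in> G" "\<alpha> < a" for a b
  proof -
    obtain n where "s1 ^ n < a - \<alpha>" using s(2) ab(2) unfolding null_powers_def by (meson diff_gt_0_iff_gt)
    then have "\<alpha> < a - s1 ^ n" by (simp add: less_diff_eq add.commute)
    then have "{lo'..b - s2 ^ n} \<in> I" using diff[OF ab(1) pow] lo I_iff by blast
    then have "\<beta> \<le> b - s2 ^ n" using \<beta> by fastforce
    then show ?thesis using s2[of n] by (simp add: le_less_trans)
  qed
  have "a \<noteq> \<alpha>" if "(a, b) \<in> G" for a b using \<alpha> that by blast
  then have side: "a < \<alpha> \<and> b < \<beta> \<or> \<alpha> < a \<and> \<beta> < b" if "(a, b) \<in> G" for a b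
    using lower upper that by (metis linorder_neqE)
  show thesis
  proof
    show "\<beta> \<notin> Range G" using side by blast
    show "a < \<alpha> \<longleftrightarrow> b < \<beta>" if "(a, b) \<in> G" for a b using side[OF that] by auto
  qed
qed

text \<open>
  After closing under roots, the given element is either matched or transcendental, and in the
  latter case its cut decides the signs of all polynomials.
\<close>

lemma exists_small_extension_to_element:
  fixes G :: "('a::linordered_field \<times> 'b::linordered_field) set"
  assumes rc: "real_closed TYPE('a)" "real_closed TYPE('b)" and cc: "cantor_complete TYPE('b)"
    and G: "ordered_partial_iso G" "small G"
    and s: "(s1, s2) \<in> G" "null_powers s1" "null_powers s2"
  shows "\<exists>H. G \<subseteq> H \<and> ordered_partial_iso H \<and> small H \<and> x \<in> Domain H"
proof -
  interpret G: ordered_partial_iso G by (rule G)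
  have pow: "(inverse (s1 ^ n), inverse (s2 ^ n)) \<in> G" for n
    by (intro G.inverse G.power s)
  have "\<exists>a\<in>Domain G. x < a" for x
    by (rule null_powers_cofinal[OF s(2), of x]) (use pow in blast)
  moreover have "\<exists>b\<in>Range G. y < b" for y
    by (rule null_powers_cofinal[OF s(3), of y]) (use pow in blast)
  ultimately obtain M where M: "G \<subseteq> M" "ordered_partial_iso M" "small M" "\<And>d. root_closed_below d M"
    using exists_small_root_closed_extension[OF rc G] by blast
  interpret M: ordered_partial_iso M by (rule M)
  show ?thesis
  proof (cases "x \<in> Domain M")
    case True
    then show ?thesis using M by blast
  next
    case False
    have "(s1, s2) \<in> M" using s M by blast
    then obtain \<beta> where \<beta>: "\<beta> \<notin> Range M" "\<And>a b. (a, b) \<in> M \<Longrightarrow> a < x \<longleftrightarrow> b < \<beta>"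
      using M.exists_matching_cut[OF cc M(3) _ s(2) False] by blast
    have sign: "same_sign (poly p x) (poly q \<beta>)" if "poly_pair M p q" for p q
      using M.same_sign_at_cut[OF rc M(4)[of "Suc (degree p)"] False \<beta> that] by simp
    have "small (adjoin_pair M x \<beta>)" by (rule small_adjoin_pair[OF M(3)])
    then show ?thesis
      using M.adjoin_pair_iso[OF sign] M(1) by (intro exI[of _ "adjoin_pair M x \<beta>"]) auto
  qed
qed


section \<open>The prime field with the scale\<close>

text \<open>
  The term \<open>s p(s)\<close> is infinitesimal, because \<open>p(s)\<close> is bounded by an integer.
\<close>

lemma sign_of_rational_poly_at_infinitesimal:
  fixes s :: "'a::linordered_field"
  assumes s: "0 < s" "\<And>n. 1 \<le> n \<Longrightarrow> s < 1 / of_nat n"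
    and p: "\<And>i. coeff p i \<in> range of_rat" and a: "a \<noteq> 0"
  shows "same_sign (of_rat a + s * poly p s) a"
proof -
  have s1: "s < 1" using s(2)[of 1] by simp
  have "\<exists>N. \<bar>poly p s\<bar> \<le> of_nat N"
    using p
  proof (induction p)
    case 0
    show ?case by (intro exI[of _ 0]) simp
  next
    case (pCons c p)
    have "coeff p i \<in> range of_rat" for i
      using pCons.prems[of "Suc i"] by simp
    then obtain N where N: "\<bar>poly p s\<bar> \<le> of_nat N" using pCons.IH by blast
    obtain r where r: "c = of_rat r" using pCons.prems[of 0] by auto
    obtain n where n: "\<bar>r\<bar> \<le> of_nat n" using real_arch_simple by blast
    have "\<bar>c\<bar> \<le> of_rat (of_nat n)"
      using n by (simp only: r abs_of_rat of_rat_less_eq)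
    then have "\<bar>c\<bar> \<le> of_nat n" by simp
    moreover have "\<bar>s * poly p s\<bar> \<le> 1 * of_nat N"
      unfolding abs_mult using N s(1) s1 by (intro mult_mono) auto
    ultimately have "\<bar>poly (pCons c p) s\<bar> \<le> of_nat (n + N)"
      using abs_triangle_ineq[of c "s * poly p s"] by simp
    then show ?case by blast
  qed
  then obtain N where N: "\<bar>poly p s\<bar> \<le> of_nat N" by blast
  have "\<exists>n::nat. of_nat N < \<bar>a\<bar> * of_nat n \<and> 1 \<le> n"
  proof -
    obtain n :: nat where n: "of_nat N / \<bar>a\<bar> < of_nat n" using reals_Archimedean2 by blast
    then have "of_nat N < \<bar>a\<bar> * of_nat n" using a by (simp add: divide_less_eq mult.commute)
    then show ?thesis by (cases "n = 0") auto
  qed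
  then obtain n :: nat where n: "of_nat N < \<bar>a\<bar> * of_nat n" "1 \<le> n" by blast
  have "of_rat (of_nat N) < (of_rat (\<bar>a\<bar> * of_nat n) :: 'a)"
    using n(1) by (simp only: of_rat_less)
  then have aN: "of_nat N < \<bar>of_rat a :: 'a\<bar> * of_nat n" by (simp add: of_rat_mult)
  have "\<bar>s * poly p s\<bar> = s * \<bar>poly p s\<bar>" using s(1) by (simp add: abs_mult)
  also have "\<dots> \<le> s * of_nat N" using N s(1) by simp
  also have "\<dots> \<le> (1 / of_nat n) * of_nat N" using s(2)[OF n(2)] by (intro mult_right_mono) auto
  also have "\<dots> < \<bar>of_rat a\<bar>" using aN n(2) by (simp add: divide_less_eq)
  finally have "\<bar>s * poly p s\<bar> < \<bar>of_rat a :: 'a\<bar>" .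
  then show ?thesis
    using a by (cases "a > 0") (auto simp: same_sign_def abs_if of_rat_less_0_iff zero_less_of_rat_iff split: if_splits)
qed

lemma exists_initial_partial_iso:
  fixes s1 :: "'a::linordered_field" and s2 :: "'b::linordered_field"
  assumes s1: "0 < s1" "\<And>n. 1 \<le> n \<Longrightarrow> s1 < 1 / of_nat n"
    and s2: "0 < s2" "\<And>n. 1 \<le> n \<Longrightarrow> s2 < 1 / of_nat n"
  obtains G where "ordered_partial_iso G" "small G" "(s1, s2) \<in> G"
proof -
  define Q where "Q = range (\<lambda>q. (of_rat q :: 'a, of_rat q :: 'b))"
  interpret Q: ordered_partial_iso Q
  proof
    show "(1, 1) \<in> Q" unfolding Q_def by (rule image_eqI[of _ _ 1]) auto
  next
    fix x y x' y' assume "(x, y) \<in> Q" "(x', y') \<in> Q"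
    then obtain q q' where "x = of_rat q" "y = of_rat q" "x' = of_rat q'" "y' = of_rat q'"
      by (auto simp: Q_def)
    then show "(x + x', y + y') \<in> Q" "(x * x', y * y') \<in> Q"
      unfolding Q_def
      by (auto intro: image_eqI[of _ _ "q + q'"] image_eqI[of _ _ "q * q'"] simp: of_rat_add of_rat_mult)
  next
    fix x y assume "(x, y) \<in> Q"
    then obtain q where "x = of_rat q" "y = of_rat q" by (auto simp: Q_def)
    then show "(- x, - y) \<in> Q" "(inverse x, inverse y) \<in> Q" "x = 0 \<longleftrightarrow> y = 0" "0 < x \<longleftrightarrow> 0 < y"
      unfolding Q_def
      by (auto intro: image_eqI[of _ _ "- q"] image_eqI[of _ _ "inverse q"] simp: of_rat_minus of_rat_inverse)
  qed
  have sign: "same_sign (poly p s1) (poly q s2)" if "poly_pair Q p q" for p q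
    using that
  proof (induction p q rule: poly_induct2)
    case 0
    then show ?case by (simp add: same_sign_def)
  next
    case (pCons a p b q)
    then have pq: "poly_pair Q p q" and ab: "(a, b) \<in> Q" by (simp_all add: poly_pair_pCons)
    obtain c where c: "a = of_rat c" "b = of_rat c" using ab by (auto simp: Q_def)
    show ?case
    proof (cases "c = 0")
      case True
      have "same_sign (s1 * poly p s1) (s2 * poly q s2)"
        using pCons.IH[OF pq] s1(1) s2(1) by (intro same_sign_mult) (auto simp: same_sign_def)
      then show ?thesis using c True by simp
    next
      case False
      have "coeff p i \<in> range of_rat" "coeff q i \<in> range of_rat" for i
        using pq by (auto simp: poly_pair_def Q_def)
      then have "same_sign (of_rat c + s1 * poly p s1) c" "same_sign (of_rat c + s2 * poly q s2) c"
        using False by (intro sign_of_rational_poly_at_infinitesimal s1 s2; blast)+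
      then show ?thesis using c by (simp add: same_sign_def)
    qed
  qed
  have "small Q" unfolding Q_def by (rule small_range_rat)
  then have "small (adjoin_pair Q s1 s2)" by (rule small_adjoin_pair)
  then show thesis using that Q.adjoin_pair_iso[OF sign] by blast
qed


section \<open>Back and forth along a well-order of type \<open>\<cc>\<^sup>+\<close>\<close>

text \<open>
  In a well-order of the type of the cardinal \<open>\<cc>\<^sup>+\<close> every proper initial segment is small, so the
  union of all earlier stages is again small and can be extended once more.
\<close>

lemma exists_transfinite_chain:
  fixes P :: "'g set \<Rightarrow> bool" and Q :: "'i \<Rightarrow> 'g set \<Rightarrow> bool"
  assumes card: "|UNIV :: 'i set| =o cardSuc |UNIV :: real set|"
    and init: "P G0"
    and step: "\<And>G i. P G \<Longrightarrow> \<exists>H. G \<subseteq> H \<and> P H \<and> Q i H"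
    and chain: "\<And>\<C>. \<C> \<noteq> {} \<Longrightarrow> small \<C> \<Longrightarrow> (\<And>G. G \<in> \<C> \<Longrightarrow> P G) \<Longrightarrow>
      (\<And>G H. G \<in> \<C> \<Longrightarrow> H \<in> \<C> \<Longrightarrow> G \<subseteq> H \<or> H \<subseteq> G) \<Longrightarrow> P (\<Union>\<C>)"
  obtains F :: "'i \<Rightarrow> 'g set" where "\<And>i. P (F i)" "\<And>i. Q i (F i)"
    "\<And>i j. F i \<subseteq> F j \<or> F j \<subseteq> F i"
proof -
  define r where "r = |UNIV :: 'i set|"
  have wo: "wo_rel r" unfolding r_def wo_rel_def by (rule card_of_Well_order)
  interpret wo_rel r by (rule wo)
  have field: "Field r = UNIV" by (simp add: r_def Field_card_of)
  have small_underS: "small (underS i)" for i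
  proof -
    have "|underS i| <o r"
      unfolding r_def by (rule card_of_underS[OF card_of_Card_order]) (simp add: Field_card_of)
    then have "|underS i| <o cardSuc |UNIV :: real set|"
      using card ordLess_ordIso_trans unfolding r_def by blast
    then show ?thesis
      using cardSuc_ordLeq_ordLess[OF card_of_Card_order card_of_Card_order] by blast
  qed
  define stage where "stage f i = G0 \<union> \<Union>(f ` underS i)" for f :: "'i \<Rightarrow> 'g set" and i
  define H where "H f i = (SOME Y. stage f i \<subseteq> Y \<and> P Y \<and> Q i Y)" for f i
  have "adm_wo H"
    unfolding adm_wo_def H_def stage_def by (auto intro!: arg_cong[where f = Eps] ext cong: image_cong)
  then have F: "worec H i = H (worec H) i" for i
    using worec_fixpoint by metis
  have total: "i = j \<or> i \<in> underS j \<or> j \<in> underS i" for i j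
    using TOTALS field unfolding underS_def by blast
  have good: "P (worec H i) \<and> Q i (worec H i) \<and> G0 \<subseteq> worec H i \<and>
      (\<forall>j\<in>underS i. worec H j \<subseteq> worec H i)" for i
  proof (induction i rule: well_order_induct)
    case (1 i)
    then have IH: "P (worec H j) \<and> G0 \<subseteq> worec H j \<and> (\<forall>k\<in>underS j. worec H k \<subseteq> worec H j)"
      if "j \<in> underS i" for j
      using that by (auto simp: underS_def)
    let ?C = "insert G0 (worec H ` underS i)"
    have "P (\<Union>?C)"
    proof (rule chain)
      have "small (worec H ` underS i)" by (rule small_image[OF small_underS])
      then show "small ?C" using small_Un[OF small_finite, of "{G0}"] by simp
      have "worec H j \<subseteq> worec H k \<or> worec H k \<subseteq> worec H j" if "j \<in> underS i" "k \<in> underS i" for j k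
        using total[of j k] IH[OF that(1)] IH[OF that(2)] by auto
      moreover have "G0 \<subseteq> worec H j" if "j \<in> underS i" for j
        using IH[OF that] by blast
      moreover fix G K assume "G \<in> ?C" "K \<in> ?C"
      ultimately show "G \<subseteq> K \<or> K \<subseteq> G" by fastforce
    qed (use IH init in auto)
    then have "P (stage (worec H) i)" by (simp add: stage_def)
    then have "\<exists>Y. stage (worec H) i \<subseteq> Y \<and> P Y \<and> Q i Y" using step by blast
    then have "stage (worec H) i \<subseteq> worec H i \<and> P (worec H i) \<and> Q i (worec H i)"
      unfolding F[of i] H_def[of "worec H" i] by (rule someI_ex)
    then show ?case by (auto simp: stage_def)
  qed
  show thesis
  proof
    show "P (worec H i)" "Q i (worec H i)" for i using good[of i] by blast+
    show "worec H i \<subseteq> worec H j \<or> worec H j \<subseteq> worec H i" for i j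
      using total[of i j] good[of i] good[of j] by auto
  qed
qed

lemma infinitesimal_scale_null_powers:
  fixes s :: "'a::{linordered_field, linorder_topology}"
  assumes "infinitesimal_scale s"
  shows "null_powers s"
proof -
  have s: "0 < s" "s < 1" using assms unfolding infinitesimal_scale_def by (auto dest: spec[of _ 1])
  have "\<exists>n. s ^ n < e" if "e > 0" for e
  proof -
    have "open {- e<..<e}" "0 \<in> {- e<..<e}" using that by (auto simp: open_greaterThanLessThan)
    then obtain n where n: "{- (s ^ n)<..<s ^ n} \<subseteq> {- e<..<e}"
      using assms unfolding infinitesimal_scale_def by blast
    have lt: "s ^ Suc n < s ^ n" using s by (intro power_strict_decreasing) auto
    have "0 < s ^ Suc n" "0 < s ^ n" using s by simp_all
    then have "- (s ^ n) < s ^ Suc n" by linarith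
    then have "s ^ Suc n \<in> {- (s ^ n)<..<s ^ n}" using lt by simp
    then show ?thesis using n by (meson greaterThanLessThan_iff subsetD)
  qed
  then show ?thesis using s by (simp add: null_powers_def)
qed

lemma exists_total_ordered_iso:
  fixes s1 :: "'a::{linordered_field, linorder_topology}"
    and s2 :: "'b::{linordered_field, linorder_topology}"
  assumes "scaled_field s1" "scaled_field s2"
  obtains M where "ordered_partial_iso M" "Domain M = UNIV" "Range M = UNIV" "(s1, s2) \<in> M"
proof -
  have rc: "real_closed TYPE('a)" "real_closed TYPE('b)"
    and cc: "cantor_complete TYPE('a)" "cantor_complete TYPE('b)"
    and card: "|UNIV :: 'a set| =o cardSuc |UNIV :: real set|"
      "|UNIV :: 'b set| =o cardSuc |UNIV :: real set|"
    and scale: "infinitesimal_scale s1" "infinitesimal_scale s2"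
    using assms unfolding scaled_field_def has_card_succ_continuum_def by auto
  note null = infinitesimal_scale_null_powers[OF scale(1)] infinitesimal_scale_null_powers[OF scale(2)]
  have inf: "0 < s1" "\<And>n. 1 \<le> n \<Longrightarrow> s1 < 1 / of_nat n" "0 < s2" "\<And>n. 1 \<le> n \<Longrightarrow> s2 < 1 / of_nat n"
    using scale null unfolding infinitesimal_scale_def null_powers_def by auto
  obtain G0 where G0: "ordered_partial_iso G0" "small G0" "(s1, s2) \<in> G0"
    using exists_initial_partial_iso[OF inf] .
  obtain h :: "'a \<Rightarrow> 'b" where h: "bij h"
    using card ordIso_transitive ordIso_symmetric card_of_ordIso by metis
  define P where "P G \<longleftrightarrow> ordered_partial_iso G \<and> small G \<and> (s1, s2) \<in> G" for G
  define Q where "Q i H \<longleftrightarrow> i \<in> Domain H \<and> h i \<in> Range H" for i H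
  obtain F where F: "\<And>i. P (F i)" "\<And>i. Q i (F i)" "\<And>i j. F i \<subseteq> F j \<or> F j \<subseteq> F i"
  proof (rule exists_transfinite_chain[where P = P and Q = Q, OF card(1)])
    show "P G0" using G0 by (simp add: P_def)
  next
    fix G and i :: 'a assume G: "P G"
    then obtain H where H: "G \<subseteq> H" "ordered_partial_iso H" "small H" "i \<in> Domain H"
      using exists_small_extension_to_element[OF rc cc(2) _ _ _ null] unfolding P_def by blast
    have conv: "ordered_partial_iso (H\<inverse>)" "small (H\<inverse>)" "(s2, s1) \<in> H\<inverse>"
      using ordered_partial_iso.ordered_converse[OF H(2)] small_converse[OF H(3)] G H(1)
      by (auto simp: P_def)
    obtain K where K: "H\<inverse> \<subseteq> K" "ordered_partial_iso K" "small K" "h i \<in> Domain K"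
      using exists_small_extension_to_element[OF rc(2,1) cc(1) conv null(2,1)] by blast
    have "P (K\<inverse>)"
      using ordered_partial_iso.ordered_converse[OF K(2)] small_converse[OF K(3)] K(1) conv(3)
      by (auto simp: P_def)
    moreover have "G \<subseteq> K\<inverse>" "Q i (K\<inverse>)" using G H K by (auto simp: Q_def)
    ultimately show "\<exists>H. G \<subseteq> H \<and> P H \<and> Q i H" by blast
  next
    fix \<C> assume \<C>: "\<C> \<noteq> {}" "small \<C>" "\<And>G. G \<in> \<C> \<Longrightarrow> P G"
      "\<And>G H. G \<in> \<C> \<Longrightarrow> H \<in> \<C> \<Longrightarrow> G \<subseteq> H \<or> H \<subseteq> G"
    have "ordered_partial_iso (\<Union>\<C>)"
      using \<C> by (intro ordered_partial_iso_chain_Union) (auto simp: P_def)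
    moreover have "small (\<Union>\<C>)"
      using small_UN[of \<C> "\<lambda>G. G"] \<C>(2,3) by (simp add: P_def)
    ultimately show "P (\<Union>\<C>)" using \<C>(1,3) by (auto simp: P_def)
  qed blast
  show thesis
  proof
    show "ordered_partial_iso (\<Union>(range F))"
    proof (rule ordered_partial_iso_chain_Union)
      fix G H assume "G \<in> range F" "H \<in> range F"
      then show "G \<subseteq> H \<or> H \<subseteq> G" using F(3) by blast
    qed (use F(1) in \<open>auto simp: P_def\<close>)
    show "Domain (\<Union>(range F)) = UNIV" using F(2) unfolding Q_def by blast
    show "Range (\<Union>(range F)) = UNIV"
    proof -
      have "y \<in> Range (\<Union>(range F))" for y
        using F(2)[of "inv_into UNIV h y"] bij_is_surj[OF h] unfolding Q_def
        by (metis Range_mono UN_upper UNIV_I subsetD surj_f_inv_f)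
      then show ?thesis by blast
    qed
    show "(s1, s2) \<in> \<Union>(range F)" using F(1) by (auto simp: P_def)
  qed
qed

lemma total_partial_field_iso_function:
  assumes M: "partial_field_iso M" and total: "Domain M = UNIV" "Range M = UNIV"
  obtains \<Phi> where "is_field_iso \<Phi>" "\<And>x y. (x, y) \<in> M \<longleftrightarrow> y = \<Phi> x"
proof -
  interpret partial_field_iso M by (rule M)
  have "\<forall>x. \<exists>y. (x, y) \<in> M" using total(1) by blast
  then obtain \<Phi> where \<Phi>: "\<And>x. (x, \<Phi> x) \<in> M" by metis
  have iff: "(x, y) \<in> M \<longleftrightarrow> y = \<Phi> x" for x y using \<Phi> unique_right by blast
  have "is_field_hom \<Phi>"
    unfolding is_field_hom_def using one add[OF \<Phi> \<Phi>] mult[OF \<Phi> \<Phi>] by (simp add: iff)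
  moreover have "bij \<Phi>"
  proof (rule bijI)
    show "inj \<Phi>" using \<Phi> unique_left by (metis injI)
    show "surj \<Phi>" using total(2) iff by blast
  qed
  ultimately show thesis using that iff by (simp add: is_field_iso_def)
qed

lemma is_field_iso_adjoin_i:
  assumes \<Phi>: "is_field_iso \<Phi>"
  shows "is_field_iso (\<lambda>z. Adjoin_i (\<Phi> (re_i z)) (\<Phi> (im_i z)))"
proof -
  have hom: "is_field_hom \<Phi>" and bij: "bij \<Phi>" using \<Phi> by (auto simp: is_field_iso_def)
  have "\<Phi> (x - y) = \<Phi> x - \<Phi> y" for x y
    using hom field_hom_uminus[OF hom, of y] unfolding is_field_hom_def
    by (metis add_uminus_conv_diff)
  then have "is_field_hom (\<lambda>z. Adjoin_i (\<Phi> (re_i z)) (\<Phi> (im_i z)))"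
    using hom field_hom_zero[OF hom]
    by (auto simp: is_field_hom_def plus_adjoin_i_def times_adjoin_i_def one_adjoin_i_def)
  moreover have "surj (\<lambda>z. Adjoin_i (\<Phi> (re_i z)) (\<Phi> (im_i z)))"
  proof (rule surjI)
    fix w
    show "Adjoin_i (\<Phi> (re_i (Adjoin_i (inv_into UNIV \<Phi> (re_i w)) (inv_into UNIV \<Phi> (im_i w)))))
      (\<Phi> (im_i (Adjoin_i (inv_into UNIV \<Phi> (re_i w)) (inv_into UNIV \<Phi> (im_i w))))) = w"
      using bij_is_surj[OF bij] by (simp add: surj_f_inv_f)
  qed
  ultimately show ?thesis
    using field_hom_inj by (auto simp: is_field_iso_def bij_def)
qed


section \<open>Uniqueness\<close>

theorem theorem3p1:
  fixes s1 :: "'a::{linordered_field, linorder_topology}"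
    and s2 :: "'b::{linordered_field, linorder_topology}"
  assumes "scaled_field s1" and "scaled_field s2"
  shows "(\<exists>\<Phi> :: 'a \<Rightarrow> 'b. is_field_iso \<Phi> \<and> \<Phi> s1 = s2) \<and>
         algebraically_closed TYPE('a adjoin_i) \<and>
         algebraically_closed TYPE('b adjoin_i) \<and>
         (\<exists>\<Psi> :: 'a adjoin_i \<Rightarrow> 'b adjoin_i. is_field_iso \<Psi>)"
proof -
  obtain M where M: "ordered_partial_iso M" "Domain M = UNIV" "Range M = UNIV" "(s1, s2) \<in> M"
    using exists_total_ordered_iso[OF assms] .
  obtain \<Phi> where \<Phi>: "is_field_iso \<Phi>" "\<And>x y. (x, y) \<in> M \<longleftrightarrow> y = \<Phi> x"
    using total_partial_field_iso_function[OF ordered_partial_iso.axioms(1)[OF M(1)] M(2,3)] by blast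
  have "\<Phi> s1 = s2" using M(4) \<Phi>(2) by simp
  moreover have "algebraically_closed TYPE('a adjoin_i)" "algebraically_closed TYPE('b adjoin_i)"
    using assms by (auto simp: scaled_field_def intro: real_closed_adjoin_i_algebraically_closed)
  ultimately show ?thesis
    using \<Phi>(1) is_field_iso_adjoin_i[OF \<Phi>(1)] by blast
qed

end
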